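(* Let $\rho,\eta\in\mathbb{N}$ be positive integers with $\gcd(\rho,\eta)=1$ and let $\kappa=\rho/\eta$. For $j=1,\dots,n$ let $P_j(D_x)$ be a pseudo-differential operator on $\mathbb{T}^1$ whose symbol is positively homogeneous of order $\kappa$, i.e. $p_j(\xi)=|\xi|^{\kappa}p_j(1)$ for integers $\xi>0$ and $p_j(\xi)=|\xi|^{\kappa}p_j(-1)$ for integers $\xi<0$. Write $p_j(1)=\alpha_j+i\beta_j$ and $p_j(-1)=\widetilde{\alpha}_j+i\widetilde{\beta}_j$ with $\alpha_j,\beta_j,\widetilde\alpha_j,\widetilde\beta_j\in\mathbb{R}$, and set $\alpha=(\alpha_1,\dots,\alpha_n)$, $\beta=(\beta_1,\dots,\beta_n)$, $\widetilde\alpha=(\widetilde\alpha_1,\dots,\widetilde\alpha_n)$, $\widetilde\beta=(\widetilde\beta_1,\dots,\widetilde\beta_n)$. Then the system $$L_j=D_{t_j}+P_j(D_x),\quad j=1,\dots,n,$$ on $\mathbb{T}^n_t\times\mathbb{T}^1_x$ is globally hypoelliptic if and only if both of the following hold: (1) if $\beta=0$, then $\alpha\notin\mathbb{Q}^n$ and $\alpha$ does not satisfy $(SDA)_\eta$; (2) if $\widetilde\beta=0$, then $\widetilde\alpha\notin\mathbb{Q}^n$ and $\widetilde\alpha$ does not satisfy $(SDA)_\eta$.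
   Context: $\mathbb{T}^d=(\mathbb{R}/2\pi\mathbb{Z})^d$ and $D_{t_j}=i^{-1}\partial_{t_j}$. The operator with symbol $p$ is $P(D_x)u(x)=\sum_{\xi\in\mathbb{Z}}e^{ix\xi}p(\xi)\widehat{u}(\xi)$, where $\widehat u(\xi)$ are the Fourier coefficients; it acts in the $x$ variable on functions and distributions on $\mathbb{T}^{n+1}$. A system $L_1,\dots,L_n$ on $\mathbb{T}^{n+1}$ is globally hypoelliptic if the conditions $u\in\mathcal{D}'(\mathbb{T}^{n+1})$ and $L_ju\in C^\infty(\mathbb{T}^{n+1})$ for all $j\in\{1,\dots,n\}$ imply $u\in C^\infty(\mathbb{T}^{n+1})$. Condition $(SDA)_\eta$: for $\eta\in\mathbb{N}$, a vector $\alpha=(\alpha_1,\dots,\alpha_n)\in\mathbb{R}^n\setminus\mathbb{Q}^n$ satisfies $(SDA)_\eta$ if there exist a constant $C>0$ and a sequence $(p_{1\ell},\dots,p_{n\ell},q_\ell)\in\mathbb{Z}^n\times\mathbb{N}$, $\ell\in\mathbb{N}$, with $q_\ell\to+\infty$, such that $$\max_{j=1,\dots,n}\left|\alpha_j^{\eta}-\frac{(p_{j\ell})^{\eta}}{q_\ell}\right|<C\,q_\ell^{-\ell},\quad \ell\in\mathbb{N}.$$ *)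

theory Defs
  imports "HOL-Analysis.Analysis"
begin

text \<open>Functions on the torus \<open>(\<real>/2\<pi>\<int>)\<^sup>d\<close> are functions on a Euclidean space of dimension \<open>d\<close>
  that are \<open>2\<pi>\<close>-periodic in each coordinate.\<close>

definition torus_periodic :: "('a::euclidean_space \<Rightarrow> 'b) \<Rightarrow> bool" where
  "torus_periodic f \<longleftrightarrow> (\<forall>b\<in>Basis. \<forall>x. f (x + (2 * pi) *\<^sub>R b) = f x)"

definition dir_deriv :: "'a::euclidean_space \<Rightarrow> ('a \<Rightarrow> complex) \<Rightarrow> 'a \<Rightarrow> complex" where
  "dir_deriv b f = (\<lambda>x. frechet_derivative f (at x) b)"

text \<open>A list of basis vectors plays the role of a multi-index.\<close>

definition iter_partial :: "'a::euclidean_space list \<Rightarrow> ('a \<Rightarrow> complex) \<Rightarrow> 'a \<Rightarrow> complex" where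
  "iter_partial bs f = foldr dir_deriv bs f"

definition torus_smooth :: "('a::euclidean_space \<Rightarrow> complex) set" where
  "torus_smooth = {f. torus_periodic f \<and>
     (\<forall>bs x. set bs \<subseteq> Basis \<longrightarrow> iter_partial bs f differentiable (at x))}"

definition torus_smooth_tendsto ::
    "(nat \<Rightarrow> 'a::euclidean_space \<Rightarrow> complex) \<Rightarrow> ('a \<Rightarrow> complex) \<Rightarrow> bool" where
  "torus_smooth_tendsto \<Phi> \<phi> \<longleftrightarrow>
     (\<forall>bs. set bs \<subseteq> Basis \<longrightarrow>
        uniform_limit UNIV (\<lambda>k. iter_partial bs (\<Phi> k)) (iter_partial bs \<phi>) sequentially)"

text \<open>Distributions are continuous linear functionals on the Frechet space of smooth functions on
  the torus; as this space is metrizable, continuity is sequential continuity. Only the values of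
  a functional on smooth periodic functions are meaningful.\<close>

type_synonym 'a functional = "('a \<Rightarrow> complex) \<Rightarrow> complex"

definition torus_distribution :: "'a::euclidean_space functional \<Rightarrow> bool" where
  "torus_distribution u \<longleftrightarrow>
     (\<forall>\<phi>\<in>torus_smooth. \<forall>\<psi>\<in>torus_smooth. u (\<lambda>x. \<phi> x + \<psi> x) = u \<phi> + u \<psi>) \<and>
     (\<forall>\<phi>\<in>torus_smooth. \<forall>c. u (\<lambda>x. c * \<phi> x) = c * u \<phi>) \<and>
     (\<forall>\<Phi>. \<forall>\<phi>\<in>torus_smooth. (\<forall>k. \<Phi> k \<in> torus_smooth) \<longrightarrow> torus_smooth_tendsto \<Phi> \<phi> \<longrightarrow>
        (\<lambda>k. u (\<Phi> k)) \<longlonglongrightarrow> u \<phi>)"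

text \<open>A function \<open>f\<close> is identified with the distribution \<open>\<phi> \<mapsto> \<integral> f \<phi>\<close>.\<close>

definition dist_of_fun :: "('a::euclidean_space \<Rightarrow> complex) \<Rightarrow> 'a functional" where
  "dist_of_fun f = (\<lambda>\<phi>. integral (cbox 0 ((2 * pi) *\<^sub>R One)) (\<lambda>x. f x * \<phi> x))"

definition dist_is_smooth :: "'a::euclidean_space functional \<Rightarrow> bool" where
  "dist_is_smooth u \<longleftrightarrow> (\<exists>f\<in>torus_smooth. \<forall>\<phi>\<in>torus_smooth. u \<phi> = dist_of_fun f \<phi>)"

definition globally_hypoelliptic ::
    "('j \<Rightarrow> 'a::euclidean_space functional \<Rightarrow> 'a functional) \<Rightarrow> bool" where
  "globally_hypoelliptic L \<longleftrightarrow>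
     (\<forall>u. torus_distribution u \<longrightarrow> (\<forall>j. dist_is_smooth (L j u)) \<longrightarrow> dist_is_smooth u)"

text \<open>The distributional derivative satisfies \<open>\<langle>\<partial>u, \<phi>\<rangle> = - \<langle>u, \<partial>\<phi>\<rangle>\<close>.\<close>

definition D_t :: "'n::finite \<Rightarrow> ((real ^ 'n) \<times> real) functional \<Rightarrow> ((real ^ 'n) \<times> real) functional" where
  "D_t j u = (\<lambda>\<phi>. inverse \<i> * (- u (dir_deriv (axis j 1, 0) \<phi>)))"

text \<open>The Fourier coefficient in \<open>x\<close> of a distribution in \<open>(t, x)\<close> is the distribution in \<open>t\<close>
  given by \<open>\<langle>u^(\<xi>), \<psi>\<rangle> = (2\<pi>)\<^sup>-\<^sup>1 \<langle>u, \<psi>(t) e^(-ix\<xi>)\<rangle>\<close>. Correspondingly, the distribution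
  \<open>e^(ix\<xi>) u^(\<xi>)\<close> in \<open>(t, x)\<close> maps \<open>\<phi>\<close> to \<open>\<langle>u^(\<xi>), t \<mapsto> \<integral> \<phi>(t, x) e^(ix\<xi>) dx\<rangle>\<close>, and the
  series defining \<open>P(D\<^sub>x)u\<close> is summed weakly.\<close>

definition fourier_coeff_x ::
    "((real ^ 'n::finite) \<times> real) functional \<Rightarrow> int \<Rightarrow> (real ^ 'n) functional" where
  "fourier_coeff_x u \<xi> =
     (\<lambda>\<psi>. u (\<lambda>(t, x). \<psi> t * cis (- (of_int \<xi> * x))) / complex_of_real (2 * pi))"

definition op_of_symbol ::
    "(int \<Rightarrow> complex) \<Rightarrow> ((real ^ 'n::finite) \<times> real) functional \<Rightarrow> ((real ^ 'n) \<times> real) functional" where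
  "op_of_symbol p u =
     (\<lambda>\<phi>. \<Sum>\<^sub>\<infinity>\<xi>\<in>UNIV. p \<xi> * fourier_coeff_x u \<xi>
        (\<lambda>t. integral {0..2 * pi} (\<lambda>x. \<phi> (t, x) * cis (of_int \<xi> * x))))"

definition system_op ::
    "('n::finite \<Rightarrow> int \<Rightarrow> complex) \<Rightarrow> 'n \<Rightarrow> ((real ^ 'n) \<times> real) functional \<Rightarrow>
      ((real ^ 'n) \<times> real) functional" where
  "system_op p j u = (\<lambda>\<phi>. D_t j u \<phi> + op_of_symbol (p j) u \<phi>)"

definition rational_vec :: "real ^ 'n::finite \<Rightarrow> bool" where
  "rational_vec \<alpha> \<longleftrightarrow> (\<forall>j. \<alpha> $ j \<in> \<rat>)"

text \<open>The sequences are indexed by the positive integers; the values at index 0 are irrelevant.\<close>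

definition SDA :: "nat \<Rightarrow> real ^ 'n::finite \<Rightarrow> bool" where
  "SDA \<eta> \<alpha> \<longleftrightarrow> \<not> rational_vec \<alpha> \<and>
     (\<exists>C>0. \<exists>(p :: nat \<Rightarrow> int ^ 'n) (q :: nat \<Rightarrow> nat).
        (\<forall>l\<ge>1. q l > 0) \<and> filterlim q at_top sequentially \<and>
        (\<forall>l\<ge>1. (MAX j. \<bar>(\<alpha> $ j) ^ \<eta> - real_of_int (p l $ j) ^ \<eta> / real (q l)\<bar>)
                  < C * real (q l) powi (- int l)))"

end

theory Submission
  imports Defs
begin

text \<open>The system has constant coefficients, so everything is decided on Fourier coefficients. Write
\<open>wave k\<close> for the character \<open>x \<mapsto> exp (i k\<cdot>x)\<close> with integral frequency vector \<open>k = (\<tau>, \<xi>)\<close>. Testing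
\<open>L\<^sub>j u\<close> against \<open>wave (- k)\<close> gives \<open>(\<tau>\<^sub>j + p\<^sub>j(\<xi>)) \<langle>u, wave (- k)\<rangle>\<close> (\<open>system_op_wave\<close>), and a distribution
is smooth exactly when its coefficients decay faster than every power of \<open>1 + \<bar>k\<bar>\<close>.

This leads to two criteria. If \<open>max\<^sub>j \<bar>\<tau>\<^sub>j + p\<^sub>j(\<xi>)\<bar>\<close> is bounded below by a negative power of \<open>1 + \<bar>k\<bar>\<close>
for all large \<open>k\<close>, then decay of the coefficients of all \<open>L\<^sub>j u\<close> forces decay of those of \<open>u\<close>
(\<open>globally_hypoelliptic_if_symbol_bounded_below\<close>). If, on the contrary, the numbers
\<open>\<tau>\<^sub>j + p\<^sub>j(\<xi>)\<close> decay rapidly along some sequence \<open>k\<^sub>l\<close> with distinct \<open>\<xi>\<^sub>l\<close>, then \<open>\<Sum>\<^sub>l wave k\<^sub>l\<close> is a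
non-smooth distribution with smooth images
(\<open>not_globally_hypoelliptic_if_symbol_decays\<close>). The analytic input is Fourier theory on the torus in
several variables: rapid decay of the coefficients of smooth functions (integration by parts),
smoothness of rapidly decaying series, and inversion in the smooth topology
(\<open>fourier_inversion\<close>), which rests on uniqueness of coefficients and hence on the
Stone--Weierstrass theorem.

Positive and negative \<open>\<xi>\<close> are independent. For \<open>\<xi> > 0\<close> the symbol is \<open>\<tau>\<^sub>j + \<xi>\<^sup>\<kappa> (\<alpha>\<^sub>j + i \<beta>\<^sub>j)\<close>. If some
\<open>\<beta>\<^sub>j\<close> is nonzero, the imaginary part is bounded below. If \<open>\<beta> = 0\<close>, the question is how well the
\<open>\<alpha>\<^sub>j\<close> are approximated by \<open>- \<tau>\<^sub>j / \<xi>\<^sup>\<kappa>\<close>; taking \<open>\<eta>\<close>-th powers clears the root and turns this into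
approximation of \<open>\<alpha>\<^sub>j\<^sup>\<eta>\<close> by \<open>(- \<tau>\<^sub>j)\<^sup>\<eta> / \<xi>\<^sup>\<rho>\<close>. So bad lower bounds give approximations with denominators
\<open>q = \<xi>\<^sup>\<rho>\<close>. Conversely, given \<open>p\<^sub>j\<^sup>\<eta> / q\<close> with arbitrary \<open>q\<close>, coprimality provides \<open>\<rho> b = \<eta> a + 1\<close>, and
multiplying numerator and denominator by \<open>q\<^sup>a\<^sup>\<eta>\<close> makes the denominator \<open>q\<^sup>a\<^sup>\<eta>\<^sup>+\<^sup>1 = (q\<^sup>b)\<^sup>\<rho>\<close> a
\<open>\<rho>\<close>-th power while keeping the numerator an \<open>\<eta>\<close>-th power. Rational vectors are approximated exactly in
this sense, so the two exclusions in each condition amount to a single one, \<open>\<not> approximable \<eta> \<alpha>\<close>.\<close>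

section \<open>Smooth functions on the torus\<close>

lemma iter_partial_Nil [simp]: "iter_partial [] f = f"
  by (simp add: iter_partial_def)

lemma iter_partial_Cons [simp]: "iter_partial (b # bs) f = dir_deriv b (iter_partial bs f)"
  by (simp add: iter_partial_def)

lemma iter_partial_append: "iter_partial (bs @ cs) f = iter_partial bs (iter_partial cs f)"
  by (induction bs) auto

lemma dir_deriv_eqI:
  assumes "(f has_derivative f') (at x)"
  shows "dir_deriv b f x = f' b"
  using frechet_derivative_at[OF assms] by (simp add: dir_deriv_def)

lemma torus_smooth_differentiable:
  "f \<in> torus_smooth \<Longrightarrow> set bs \<subseteq> Basis \<Longrightarrow> iter_partial bs f differentiable (at x)"
  by (simp add: torus_smooth_def)

lemma torus_smooth_has_derivative:
  "f \<in> torus_smooth \<Longrightarrow> (f has_derivative frechet_derivative f (at x)) (at x)"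
  using torus_smooth_differentiable[of f "[]"] frechet_derivative_works by auto

lemma torus_smooth_periodic: "f \<in> torus_smooth \<Longrightarrow> torus_periodic f"
  by (simp add: torus_smooth_def)

lemma torus_smooth_continuous: "f \<in> torus_smooth \<Longrightarrow> continuous_on S f"
  by (meson torus_smooth_has_derivative continuous_at_imp_continuous_on has_derivative_continuous)

lemma torus_periodic_dir_deriv:
  assumes "torus_periodic f" "\<And>x. f differentiable (at x)"
  shows "torus_periodic (dir_deriv b f)"
  unfolding torus_periodic_def
proof (intro ballI allI)
  fix c x :: 'a assume c: "c \<in> Basis"
  have eq: "(\<lambda>y. f (y + (2 * pi) *\<^sub>R c)) = f"
    using assms(1) c by (auto simp: torus_periodic_def)
  have "(f has_derivative frechet_derivative f (at (x + (2 * pi) *\<^sub>R c)))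
      (at (x + (2 * pi) *\<^sub>R c))"
    using assms(2) frechet_derivative_works by blast
  moreover have "((\<lambda>y. y + (2 * pi) *\<^sub>R c) has_derivative (\<lambda>h. h)) (at x)"
    by (auto intro!: derivative_eq_intros)
  ultimately have "((\<lambda>y. f (y + (2 * pi) *\<^sub>R c)) has_derivative
      frechet_derivative f (at (x + (2 * pi) *\<^sub>R c))) (at x)"
    using diff_chain_at[of "\<lambda>y. y + (2 * pi) *\<^sub>R c" "\<lambda>h. h" x f] by (simp add: o_def)
  then show "dir_deriv b f (x + (2 * pi) *\<^sub>R c) = dir_deriv b f x"
    unfolding eq using dir_deriv_eqI by (metis dir_deriv_def)
qed

lemma torus_smooth_dir_deriv:
  assumes "f \<in> torus_smooth" "b \<in> Basis"
  shows "dir_deriv b f \<in> torus_smooth"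
  unfolding torus_smooth_def
proof (intro CollectI conjI allI impI)
  show "torus_periodic (dir_deriv b f)"
    using assms torus_periodic_dir_deriv torus_smooth_periodic
      torus_smooth_differentiable[of f "[]"] by auto
  show "iter_partial bs (dir_deriv b f) differentiable (at x)" if "set bs \<subseteq> Basis" for bs x
    using torus_smooth_differentiable[OF assms(1), of "bs @ [b]" x] that assms(2)
    by (simp add: iter_partial_append)
qed

lemma torus_smooth_iter_partial:
  "f \<in> torus_smooth \<Longrightarrow> set bs \<subseteq> Basis \<Longrightarrow> iter_partial bs f \<in> torus_smooth"
  by (induction bs) (auto intro: torus_smooth_dir_deriv)

lemma iter_partial_add:
  assumes "f \<in> torus_smooth" "g \<in> torus_smooth" "set bs \<subseteq> Basis"
  shows "iter_partial bs (\<lambda>x. f x + g x) = (\<lambda>x. iter_partial bs f x + iter_partial bs g x)"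
  using assms(3)
proof (induction bs)
  case (Cons b bs)
  have "dir_deriv b (\<lambda>x. iter_partial bs f x + iter_partial bs g x) x =
      dir_deriv b (iter_partial bs f) x + dir_deriv b (iter_partial bs g) x" for x
    using Cons.prems
    by (subst dir_deriv_eqI) (auto intro!: has_derivative_add torus_smooth_has_derivative
        torus_smooth_iter_partial assms simp: dir_deriv_def)
  then show ?case using Cons by auto
qed auto

lemma iter_partial_cmult:
  assumes "f \<in> torus_smooth" "set bs \<subseteq> Basis"
  shows "iter_partial bs (\<lambda>x. c * f x) = (\<lambda>x. c * iter_partial bs f x)"
  using assms(2)
proof (induction bs)
  case (Cons b bs)
  have "dir_deriv b (\<lambda>x. c * iter_partial bs f x) x = c * dir_deriv b (iter_partial bs f) x" for x
    using Cons.prems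
    by (subst dir_deriv_eqI) (auto intro!: has_derivative_mult_right torus_smooth_has_derivative
        torus_smooth_iter_partial assms simp: dir_deriv_def)
  then show ?case using Cons by auto
qed auto

lemma torus_smooth_add:
  assumes "f \<in> torus_smooth" "g \<in> torus_smooth"
  shows "(\<lambda>x. f x + g x) \<in> torus_smooth"
  using assms iter_partial_add[OF assms] unfolding torus_smooth_def torus_periodic_def by auto

lemma torus_smooth_cmult:
  assumes "f \<in> torus_smooth"
  shows "(\<lambda>x. c * f x) \<in> torus_smooth"
  using assms iter_partial_cmult[OF assms] unfolding torus_smooth_def torus_periodic_def by auto

lemma torus_smooth_zero: "(\<lambda>x. 0) \<in> torus_smooth"
proof -
  have "iter_partial bs (\<lambda>x. 0) = (\<lambda>x::'a. 0 :: complex)" for bs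
  proof (induction bs)
    case (Cons b bs)
    then show ?case
      by (auto intro!: dir_deriv_eqI[where f' = "\<lambda>_. 0"])
  qed auto
  then show ?thesis by (simp add: torus_smooth_def torus_periodic_def)
qed

lemma torus_smooth_sum:
  "finite A \<Longrightarrow> (\<And>i. i \<in> A \<Longrightarrow> f i \<in> torus_smooth) \<Longrightarrow> (\<lambda>x. \<Sum>i\<in>A. f i x) \<in> torus_smooth"
  by (induction A rule: finite_induct) (auto intro: torus_smooth_zero torus_smooth_add)

section \<open>Characters and rapidly decaying series\<close>

definition freqs :: "'a::euclidean_space set" where
  "freqs = {k. \<forall>b\<in>Basis. k \<bullet> b \<in> \<int>}"

definition wave :: "'a::euclidean_space \<Rightarrow> 'a \<Rightarrow> complex" where
  "wave k x = cis (k \<bullet> x)"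

definition weight :: "'a::euclidean_space \<Rightarrow> real" where
  "weight k = 1 + norm k"

lemma weight_ge_1 [simp]: "1 \<le> weight k" and weight_pos [simp]: "0 < weight k"
  by (auto simp: weight_def add_pos_nonneg)

lemma weight_nonneg [simp]: "0 \<le> weight k"
  using weight_pos less_imp_le by blast

lemma weight_minus [simp]: "weight (- k) = weight k"
  by (simp add: weight_def)

lemma freqs_zero [simp]: "0 \<in> freqs"
  by (simp add: freqs_def)

lemma freqs_add: "k \<in> freqs \<Longrightarrow> l \<in> freqs \<Longrightarrow> k + l \<in> freqs"
  by (auto simp: freqs_def inner_add_left)

lemma freqs_minus_iff [simp]: "- k \<in> freqs \<longleftrightarrow> k \<in> freqs"
  by (auto simp: freqs_def)

lemma freqs_Basis: "b \<in> Basis \<Longrightarrow> b \<in> freqs"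
  by (auto simp: freqs_def inner_Basis)

lemma norm_wave [simp]: "norm (wave k x) = 1"
  by (simp add: wave_def)

lemma wave_zero [simp]: "wave 0 x = 1"
  by (simp add: wave_def)

lemma wave_add: "wave (k + l) x = wave k x * wave l x"
  by (simp add: wave_def cis_mult inner_add_left)

lemma wave_has_derivative:
  "(wave k has_derivative (\<lambda>h. \<i> * of_real (k \<bullet> h) * wave k x)) (at x)"
proof -
  have "((\<lambda>x. \<i> * of_real (k \<bullet> x)) has_derivative (\<lambda>h. \<i> * complex_of_real (k \<bullet> h))) (at x)"
    by (auto intro!: derivative_eq_intros)
  from diff_chain_at[OF this DERIV_exp[unfolded has_field_derivative_def]]
  show ?thesis
    unfolding wave_def[abs_def] cis_conv_exp by (simp add: o_def mult.commute)
qed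

lemma continuous_on_wave [continuous_intros]: "continuous_on S (wave k)"
  by (meson wave_has_derivative continuous_at_imp_continuous_on has_derivative_continuous)

lemma torus_periodic_wave:
  assumes "k \<in> freqs"
  shows "torus_periodic (wave k)"
  unfolding torus_periodic_def
proof (intro ballI allI)
  fix b x :: 'a assume "b \<in> Basis"
  then have "k \<bullet> b \<in> \<int>" using assms by (simp add: freqs_def)
  then have "cis (k \<bullet> b * (2 * pi)) = 1"
    by (metis Ints_cases cis_multiple_2pi mult.commute Ints_of_int)
  then show "wave k (x + (2 * pi) *\<^sub>R b) = wave k x"
    by (simp add: wave_def inner_add_right cis_mult[symmetric] mult.commute)
qed

text \<open>The factor by which an iterated partial derivative multiplies \<open>wave k\<close>.\<close>
definition symbol_of_partials :: "'a::euclidean_space list \<Rightarrow> 'a \<Rightarrow> complex" where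
  "symbol_of_partials bs k = (\<Prod>b\<leftarrow>bs. \<i> * of_real (k \<bullet> b))"

lemma norm_symbol_of_partials:
  assumes "set bs \<subseteq> Basis"
  shows "norm (symbol_of_partials bs k) \<le> weight k ^ length bs"
  using assms
proof (induction bs)
  case (Cons b bs)
  have "\<bar>k \<bullet> b\<bar> \<le> weight k"
    using Cons.prems Basis_le_norm[of b k] by (simp add: weight_def)
  then have "\<bar>k \<bullet> b\<bar> * norm (symbol_of_partials bs k) \<le> weight k * weight k ^ length bs"
    using Cons by (intro mult_mono) auto
  then show ?case by (simp add: symbol_of_partials_def norm_mult)
qed (simp add: symbol_of_partials_def)

text \<open>Termwise differentiation. The norms of the differentiated terms, as linear maps, are dominated by the
summable sequence \<open>norm (c n) * weight (k n)\<close>, so the tails of the derivative series are small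
uniformly in the point.\<close>
lemma wave_series_has_derivative:
  fixes k :: "nat \<Rightarrow> 'a::euclidean_space"
  assumes "summable (\<lambda>n. norm (c n) * weight (k n))"
  shows "((\<lambda>x. \<Sum>n. c n * wave (k n) x) has_derivative
    (\<lambda>h. \<Sum>n. c n * (\<i> * of_real (k n \<bullet> h)) * wave (k n) x)) (at x)"
proof -
  have s0: "summable (\<lambda>n. c n * wave (k n) x)" for x
    by (rule summable_comparison_test'[OF assms, of 0]) (simp add: norm_mult mult_le_cancel_left1)
  have bd: "norm (c n * (\<i> * of_real (k n \<bullet> h)) * wave (k n) x) \<le> (norm (c n) * weight (k n)) * norm h"
    for n h x
  proof -
    have "\<bar>k n \<bullet> h\<bar> \<le> weight (k n) * norm h"
      using Cauchy_Schwarz_ineq2[of "k n" h] unfolding weight_def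
      by (smt (verit) mult_right_mono norm_ge_zero)
    then show ?thesis by (simp add: norm_mult mult.assoc mult_left_mono)
  qed
  have s1: "summable (\<lambda>n. norm (c n * (\<i> * of_real (k n \<bullet> h)) * wave (k n) x))" for h x
    by (rule summable_comparison_test'[OF summable_mult2[OF assms, of "norm h"], of 0])
      (use bd in simp)
  define T where "T = (\<lambda>n. \<Sum>i. norm (c (i + n)) * weight (k (i + n)))"
  have T0: "T \<longlonglongrightarrow> 0"
    unfolding T_def using suminf_exist_split2[OF assms] by simp
  have "\<exists>g. \<forall>x\<in>UNIV. (\<lambda>n. c n * wave (k n) x) sums g x \<and>
     (g has_derivative (\<lambda>h. \<Sum>n. c n * (\<i> * of_real (k n \<bullet> h)) * wave (k n) x)) (at x within UNIV)"
  proof (rule has_derivative_series)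
    show "((\<lambda>x. c n * wave (k n) x) has_derivative (\<lambda>h. c n * (\<i> * of_real (k n \<bullet> h)) * wave (k n) x))
       (at x within UNIV)" for n x
      using has_derivative_mult_right[OF wave_has_derivative[of "k n" x], of "c n"]
      by (simp add: mult.assoc)
    show "(\<lambda>n. c n * wave (k n) 0) sums (\<Sum>n. c n * wave (k n) 0)"
      using s0 summable_sums by blast
    fix e :: real assume "e > 0"
    then have "\<forall>\<^sub>F n in sequentially. T n < e"
      using T0 order_tendstoD(2) by blast
    then show "\<forall>\<^sub>F n in sequentially. \<forall>x\<in>UNIV. \<forall>h.
        norm ((\<Sum>i<n. c i * (\<i> * of_real (k i \<bullet> h)) * wave (k i) x)
          - (\<Sum>i. c i * (\<i> * of_real (k i \<bullet> h)) * wave (k i) x)) \<le> e * norm h"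
    proof eventually_elim
      case (elim n)
      show ?case
      proof (intro ballI allI)
        fix x h :: 'a
        let ?f = "\<lambda>i. c i * (\<i> * of_real (k i \<bullet> h)) * wave (k i) x"
        have "(\<Sum>i. ?f i) = (\<Sum>i. ?f (i + n)) + (\<Sum>i<n. ?f i)"
          using suminf_split_initial_segment summable_norm_cancel[OF s1] by blast
        then have "norm ((\<Sum>i<n. ?f i) - (\<Sum>i. ?f i)) = norm (\<Sum>i. ?f (i + n))"
          by simp
        also have "\<dots> \<le> (\<Sum>i. norm (?f (i + n)))"
          using s1 by (intro summable_norm) (simp only: summable_iff_shift[of "\<lambda>i. norm (?f i)"])
        also have "\<dots> \<le> (\<Sum>i. (norm (c (i + n)) * weight (k (i + n))) * norm h)"
          using s1 bd summable_mult2[OF assms]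
          by (intro suminf_le) (auto simp only: summable_iff_shift[of "\<lambda>i. norm (?f i)"]
              summable_iff_shift[of "\<lambda>i. (norm (c i) * weight (k i)) * norm h"])
        also have "\<dots> = T n * norm h"
          unfolding T_def using assms
          by (intro suminf_mult2[symmetric]) (simp only: summable_iff_shift[of "\<lambda>i. norm (c i) * weight (k i)"])
        also have "\<dots> \<le> e * norm h"
          using elim by (intro mult_right_mono) auto
        finally show "norm ((\<Sum>i<n. ?f i) - (\<Sum>i. ?f i)) \<le> e * norm h" .
      qed
    qed
  qed auto
  then obtain g where g: "\<And>x. (\<lambda>n. c n * wave (k n) x) sums g x"
    "\<And>x. (g has_derivative (\<lambda>h. \<Sum>n. c n * (\<i> * of_real (k n \<bullet> h)) * wave (k n) x)) (at x)"
    by auto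
  have "g = (\<lambda>x. \<Sum>n. c n * wave (k n) x)"
    using g(1) sums_unique by blast
  then show ?thesis using g(2) by simp
qed

text \<open>Coefficients are indexed by \<open>nat\<close> through a sequence of frequencies. The same notion then serves
both an enumeration of all frequencies and a sparse sequence of resonant ones.\<close>
definition rapidly_decaying :: "(nat \<Rightarrow> 'a::euclidean_space) \<Rightarrow> (nat \<Rightarrow> complex) \<Rightarrow> bool" where
  "rapidly_decaying k c \<longleftrightarrow> (\<forall>N. \<exists>C. \<forall>n. norm (c n) * weight (k n) ^ N \<le> C)"

definition freq_coords :: "'a::euclidean_space \<Rightarrow> 'a \<Rightarrow> int" where
  "freq_coords v = restrict (\<lambda>b. \<lfloor>v \<bullet> b\<rfloor>) Basis"

lemma freq_coords: "v \<in> freqs \<Longrightarrow> b \<in> Basis \<Longrightarrow> of_int (freq_coords v b) = v \<bullet> b"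
  by (auto simp: freq_coords_def freqs_def)

lemma inj_on_freq_coords: "inj_on freq_coords freqs"
  by (rule inj_onI) (metis euclidean_eqI freq_coords)

text \<open>Since \<open>1 + (k\<bullet>b)\<^sup>2 \<le> (weight k)\<^sup>2\<close> in every coordinate, the terms are dominated by
\<open>\<Prod>b. 1 / (1 + (k\<bullet>b)\<^sup>2)\<close>. A finite set of distinct frequencies lies in a box, over which the sum of this
product factors into one-dimensional sums, each bounded by a constant \<open>S\<close>.\<close>
lemma summable_weight:
  fixes k :: "nat \<Rightarrow> 'a::euclidean_space"
  assumes "inj k" "range k \<subseteq> freqs"
  shows "summable (\<lambda>n. 1 / weight (k n) ^ (2 * DIM('a)))"
proof -
  define h :: "int \<Rightarrow> real" where "h m = 1 / (1 + (of_int m)\<^sup>2)" for m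
  have h_nn: "h m \<ge> 0" for m by (simp add: h_def)
  obtain S where S: "\<And>F. finite F \<Longrightarrow> sum h F \<le> S"
  proof -
    have sn: "summable (\<lambda>n. h (int n))"
    proof (rule summable_comparison_test'[of "\<lambda>n. inverse (real n ^ 2)" 1])
      show "summable (\<lambda>n. inverse (real n ^ 2))"
        by (rule inverse_power_summable) simp
    next
      fix n :: nat assume "n \<ge> 1"
      then show "norm (h (int n)) \<le> inverse (real n ^ 2)"
        unfolding h_def inverse_eq_divide
        by (simp add: frac_le)
    qed
    have "sum h F \<le> 2 * (\<Sum>n. h (int n))" if "finite F" for F
    proof -
      have "sum h F \<le> sum h (F \<inter> {0..}) + sum h (F \<inter> {..0})"
      proof -
        have "F = (F \<inter> {0..}) \<union> (F \<inter> {..0})" by auto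
        then show ?thesis
          using sum.union_inter[of "F \<inter> {0..}" "F \<inter> {..0}" h] that
            sum_nonneg[of "(F \<inter> {0..}) \<inter> (F \<inter> {..0})" h] h_nn by simp
      qed
      also have "sum h (F \<inter> {0..}) = sum (\<lambda>n. h (int n)) (nat ` (F \<inter> {0..}))"
        by (subst sum.reindex) (auto intro!: inj_onI sum.cong)
      also have "\<dots> \<le> (\<Sum>n. h (int n))"
        using that h_nn sn by (intro sum_le_suminf) auto
      also have "sum h (F \<inter> {..0}) = sum (\<lambda>n. h (int n)) ((\<lambda>m. nat (- m)) ` (F \<inter> {..0}))"
        by (subst sum.reindex) (auto intro!: inj_onI sum.cong simp: h_def)
      also have "\<dots> \<le> (\<Sum>n. h (int n))"
        using that h_nn sn by (intro sum_le_suminf) auto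
      finally show ?thesis by simp
    qed
    then show ?thesis using that by blast
  qed
  have S0: "S \<ge> 0" using S[of "{}"] by simp
  have term_le: "1 / weight v ^ (2 * DIM('a)) \<le> (\<Prod>b\<in>Basis. h (freq_coords v b))" if "v \<in> freqs" for v :: 'a
  proof -
    have "(\<Prod>b\<in>(Basis::'a set). 1 / (weight v)\<^sup>2) \<le> (\<Prod>b\<in>Basis. h (freq_coords v b))"
    proof (rule prod_mono)
      fix b :: 'a assume b: "b \<in> Basis"
      have "(v \<bullet> b)\<^sup>2 \<le> (norm v)\<^sup>2"
        using Basis_le_norm[OF b, of v] by (metis abs_ge_zero power2_abs power_mono)
      then have "1 + (v \<bullet> b)\<^sup>2 \<le> (weight v)\<^sup>2"
        unfolding weight_def power2_sum one_power2 mult_1_right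
        using norm_ge_zero[of v] by linarith
      then show "0 \<le> 1 / (weight v)\<^sup>2 \<and> 1 / (weight v)\<^sup>2 \<le> h (freq_coords v b)"
        unfolding h_def freq_coords[OF that b] by (intro conjI frac_le) (auto simp: add_pos_nonneg)
    qed
    then show ?thesis by (simp add: power_mult power_divide)
  qed
  show ?thesis
  proof (rule bounded_imp_summable)
    show "0 \<le> 1 / weight (k n) ^ (2 * DIM('a))" for n by simp
    fix n
    let ?F = "k ` {..n}"
    let ?B = "\<lambda>b. (\<lambda>v. freq_coords v b) ` ?F"
    have kf: "k i \<in> freqs" for i using assms(2) by auto
    have "(\<Sum>i\<le>n. 1 / weight (k i) ^ (2 * DIM('a))) \<le> (\<Sum>i\<le>n. \<Prod>b\<in>Basis. h (freq_coords (k i) b))"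
      using term_le kf by (intro sum_mono) auto
    also have "\<dots> = (\<Sum>f\<in>freq_coords ` ?F. \<Prod>b\<in>Basis. h (f b))"
    proof -
      have "inj_on (\<lambda>i. freq_coords (k i)) {..n}"
        using inj_onD[OF inj_on_freq_coords _ kf kf] injD[OF assms(1)] by (blast intro: inj_onI)
      then show ?thesis
        unfolding image_image by (simp add: sum.reindex)
    qed
    also have "\<dots> \<le> (\<Sum>f\<in>PiE Basis ?B. \<Prod>b\<in>Basis. h (f b))"
    proof (rule sum_mono2)
      show "finite (PiE Basis ?B)" by (intro finite_PiE) auto
      show "freq_coords ` ?F \<subseteq> PiE Basis ?B" by (auto simp: freq_coords_def)
    qed (auto intro: prod_nonneg h_nn)
    also have "\<dots> = (\<Prod>b\<in>Basis. \<Sum>m\<in>?B b. h m)"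
      by (rule prod_sum_PiE[symmetric]) auto
    also have "\<dots> \<le> (\<Prod>b\<in>(Basis::'a set). S)"
      by (rule prod_mono) (auto intro!: sum_nonneg h_nn S)
    finally show "(\<Sum>i\<le>n. 1 / weight (k i) ^ (2 * DIM('a))) \<le> S ^ DIM('a)" by simp
  qed
qed

lemma rapidly_decaying_summable:
  fixes k :: "nat \<Rightarrow> 'a::euclidean_space"
  assumes "inj k" "range k \<subseteq> freqs" "rapidly_decaying k c"
  shows "summable (\<lambda>n. norm (c n) * weight (k n) ^ N)"
proof -
  obtain C where C: "\<And>n. norm (c n) * weight (k n) ^ (N + 2 * DIM('a)) \<le> C"
    using assms(3) unfolding rapidly_decaying_def by blast
  show ?thesis
  proof (rule summable_comparison_test'[OF summable_mult[OF summable_weight[OF assms(1,2)], of C], of 0])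
    fix n
    have "norm (c n) * weight (k n) ^ N * weight (k n) ^ (2 * DIM('a)) \<le> C"
      using C[of n] by (simp add: power_add mult.assoc)
    then show "norm (norm (c n) * weight (k n) ^ N) \<le> C * (1 / weight (k n) ^ (2 * DIM('a)))"
      by (simp add: field_simps)
  qed
qed

text \<open>Differentiability is carried along in the induction because the next derivative needs it.\<close>
lemma iter_partial_wave_series:
  fixes k :: "nat \<Rightarrow> 'a::euclidean_space"
  assumes "\<And>N. summable (\<lambda>n. norm (c n) * weight (k n) ^ N)" "set bs \<subseteq> Basis"
  shows "iter_partial bs (\<lambda>x. \<Sum>n. c n * wave (k n) x) =
      (\<lambda>x. \<Sum>n. (c n * symbol_of_partials bs (k n)) * wave (k n) x) \<and>
    (\<forall>x. (iter_partial bs (\<lambda>x. \<Sum>n. c n * wave (k n) x)) differentiable (at x))"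
  using assms(2)
proof (induction bs)
  case Nil
  show ?case
    using wave_series_has_derivative[of c k] assms(1)[of 1]
    by (auto simp: symbol_of_partials_def intro!: differentiableI)
next
  case (Cons b bs)
  have summ: "summable (\<lambda>n. norm (c n * symbol_of_partials cs (k n)) * weight (k n))"
    if "set cs \<subseteq> Basis" for cs
  proof (rule summable_comparison_test'[OF assms(1)[of "length cs + 1"], of 0])
    fix n
    show "norm (norm (c n * symbol_of_partials cs (k n)) * weight (k n)) \<le>
        norm (c n) * weight (k n) ^ (length cs + 1)"
      using norm_symbol_of_partials[OF that, of "k n"]
      by (simp add: norm_mult mult.assoc mult.commute mult_left_mono)
  qed
  have "dir_deriv b (\<lambda>x. \<Sum>n. (c n * symbol_of_partials bs (k n)) * wave (k n) x) x =
      (\<Sum>n. (c n * symbol_of_partials (b # bs) (k n)) * wave (k n) x)" for x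
    using Cons.prems
    by (subst dir_deriv_eqI[OF wave_series_has_derivative[OF summ]])
      (auto simp: symbol_of_partials_def algebra_simps)
  then have eq: "iter_partial (b # bs) (\<lambda>x. \<Sum>n. c n * wave (k n) x) =
      (\<lambda>x. \<Sum>n. (c n * symbol_of_partials (b # bs) (k n)) * wave (k n) x)"
    using Cons by auto
  show ?case
    unfolding eq using wave_series_has_derivative[OF summ[OF Cons.prems]]
    by (auto intro!: differentiableI)
qed

lemma wave_series_smooth:
  fixes k :: "nat \<Rightarrow> 'a::euclidean_space"
  assumes "inj k" "range k \<subseteq> freqs" "rapidly_decaying k c"
  shows "(\<lambda>x. \<Sum>n. c n * wave (k n) x) \<in> torus_smooth"
proof -
  have "torus_periodic (wave (k n))" for n
    using assms(2) torus_periodic_wave by blast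
  then have "torus_periodic (\<lambda>x. \<Sum>n. c n * wave (k n) x)"
    by (simp add: torus_periodic_def)
  then show ?thesis
    using iter_partial_wave_series[OF rapidly_decaying_summable[OF assms], THEN conjunct2]
    by (simp only: torus_smooth_def) blast
qed

lemma iter_partial_wave_multiple:
  assumes "set bs \<subseteq> Basis"
  shows "iter_partial bs (\<lambda>x. c * wave k x) = (\<lambda>x. c * symbol_of_partials bs k * wave k x)"
  using assms
proof (induction bs)
  case (Cons b bs)
  then show ?case
    by (auto intro!: ext dir_deriv_eqI[THEN trans] has_derivative_mult_right wave_has_derivative
        simp: symbol_of_partials_def)
qed (simp add: symbol_of_partials_def)

lemma wave_multiple_smooth:
  assumes "k \<in> freqs"
  shows "(\<lambda>x. c * wave k x) \<in> torus_smooth"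
proof -
  have "(\<lambda>x. c * symbol_of_partials bs k * wave k x) differentiable (at x)" for bs x
    using has_derivative_mult_right[OF wave_has_derivative] differentiableI by blast
  then show ?thesis
    using torus_periodic_wave[OF assms] iter_partial_wave_multiple[of _ c k]
    by (simp add: torus_smooth_def torus_periodic_def)
qed

lemma wave_smooth: "k \<in> freqs \<Longrightarrow> wave k \<in> torus_smooth"
  using wave_multiple_smooth[of k 1] by simp

section \<open>Fourier coefficients of smooth functions\<close>

abbreviation cell :: "'a::euclidean_space set" where
  "cell \<equiv> cbox 0 ((2 * pi) *\<^sub>R One)"

lemma cell_iff: "x \<in> cell \<longleftrightarrow> (\<forall>b\<in>Basis. 0 \<le> x \<bullet> b \<and> x \<bullet> b \<le> 2 * pi)"
  by (auto simp: mem_box)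

lemma zero_in_cell [simp]: "0 \<in> cell"
  by (simp add: cell_iff)

lemma box_cell_nonempty: "box 0 ((2 * pi) *\<^sub>R One :: 'a::euclidean_space) \<noteq> {}"
  by (auto simp: box_ne_empty)

lemma volume_cell_pos: "0 < measure lborel (cell :: 'a::euclidean_space set)"
  using box_cell_nonempty content_pos_lt_eq by (metis box_ne_empty(2))

text \<open>The shifted cell sticks out of the cell beyond the hyperplane \<open>x \<bullet> b = 2 * pi\<close>; by periodicity the
protruding slab may be moved back to the opposite side, where it fills the gap.\<close>
lemma integral_cell_shift:
  fixes f :: "'a::euclidean_space \<Rightarrow> complex"
  assumes per: "torus_periodic f" and cont: "continuous_on UNIV f" and b: "b \<in> Basis"
    and s: "0 \<le> s" "s \<le> 2 * pi"
  shows "integral cell (\<lambda>x. f (x + s *\<^sub>R b)) = integral cell f"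
proof -
  have int: "f integrable_on cbox u v" for u v
    by (meson cont continuous_on_subset integrable_continuous subset_UNIV)
  have ip: "c *\<^sub>R b \<bullet> i = (if i = b then c else 0)" if "i \<in> Basis" for c i
    using that b by (auto simp: inner_Basis)
  let ?P = "(2 * pi) *\<^sub>R One :: 'a"
  let ?low = "cbox 0 (?P + (s - 2 * pi) *\<^sub>R b)"
  let ?high = "cbox (s *\<^sub>R b) ?P"
  have oi: "?P \<bullet> i = 2 * pi" if "i \<in> Basis" for i :: 'a using that by simp
  have "integral cell (\<lambda>x. f (x + s *\<^sub>R b)) = integral (cbox (s *\<^sub>R b) (?P + s *\<^sub>R b)) f"
    using integral_shift_cbox[of "s *\<^sub>R b" "s *\<^sub>R b" "?P + s *\<^sub>R b" f] by simp
  also have "\<dots> = integral (cbox (s *\<^sub>R b) (?P + s *\<^sub>R b) \<inter> {x. x \<bullet> b \<le> 2 * pi}) f +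
      integral (cbox (s *\<^sub>R b) (?P + s *\<^sub>R b) \<inter> {x. x \<bullet> b \<ge> 2 * pi}) f"
    by (rule integral_split[OF int b])
  also have "cbox (s *\<^sub>R b) (?P + s *\<^sub>R b) \<inter> {x. x \<bullet> b \<le> 2 * pi} = ?high"
    using b s by (auto simp: mem_box inner_add_left ip oi simp del: inner_scaleR_left split: if_splits) force
  also have "cbox (s *\<^sub>R b) (?P + s *\<^sub>R b) \<inter> {x. x \<bullet> b \<ge> 2 * pi} =
      cbox ((2 * pi) *\<^sub>R b) (?P + s *\<^sub>R b)"
    using b s by (auto simp: mem_box inner_add_left ip oi simp del: inner_scaleR_left split: if_splits) force+
  also have "integral (cbox ((2 * pi) *\<^sub>R b) (?P + s *\<^sub>R b)) f =
      integral ?low (\<lambda>x. f (x + (2 * pi) *\<^sub>R b))"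
    using integral_shift_cbox[of "(2 * pi) *\<^sub>R b" "(2 * pi) *\<^sub>R b" "?P + s *\<^sub>R b" f]
    by (simp add: algebra_simps)
  also have "\<dots> = integral ?low f"
    using per b by (simp add: torus_periodic_def)
  also have "integral ?high f + integral ?low f = integral cell f"
  proof -
    have "cell \<inter> {x. x \<bullet> b \<le> s} = ?low" "cell \<inter> {x. x \<bullet> b \<ge> s} = ?high"
      using b s by (auto simp: mem_box inner_add_left ip oi simp del: inner_scaleR_left split: if_splits) force+
    then show ?thesis using integral_split[OF int b, of 0 ?P s] by simp
  qed
  finally show ?thesis .
qed

text \<open>By translation invariance \<open>s \<mapsto> \<integral> h (x + s b) dx\<close> is constant; its derivative at \<open>0\<close> is the
integral of the partial derivative. This avoids slicing the space along \<open>b\<close>.\<close>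
lemma integral_dir_deriv_eq_0:
  fixes h :: "'a::euclidean_space \<Rightarrow> complex"
  assumes per: "torus_periodic h" and diff: "\<And>x. h differentiable (at x)"
    and cont: "continuous_on UNIV (dir_deriv b h)" and b: "b \<in> Basis"
  shows "integral cell (dir_deriv b h) = 0"
proof -
  let ?U = "cbox 0 (1::real)"
  have hc: "continuous_on UNIV h"
    by (intro continuous_at_imp_continuous_on ballI differentiable_imp_continuous_within diff)
  have "((\<lambda>s. integral cell (\<lambda>x. h (x + s *\<^sub>R b))) has_vector_derivative
      integral cell (\<lambda>x. dir_deriv b h (x + 0 *\<^sub>R b))) (at 0 within ?U)"
  proof (rule leibniz_rule_vector_derivative)
    fix s :: real and x :: 'a
    have "((\<lambda>s. x + s *\<^sub>R b) has_derivative (\<lambda>t. t *\<^sub>R b)) (at s)"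
      by (auto intro!: derivative_eq_intros)
    moreover have hd: "(h has_derivative frechet_derivative h (at (x + s *\<^sub>R b))) (at (x + s *\<^sub>R b))"
      using diff frechet_derivative_works by blast
    ultimately have "((\<lambda>s. h (x + s *\<^sub>R b)) has_derivative
        (\<lambda>t. frechet_derivative h (at (x + s *\<^sub>R b)) (t *\<^sub>R b))) (at s)"
      using diff_chain_at by (fastforce simp: o_def)
    then have "((\<lambda>s. h (x + s *\<^sub>R b)) has_vector_derivative dir_deriv b h (x + s *\<^sub>R b)) (at s)"
      unfolding has_vector_derivative_def dir_deriv_def
      using linear_scale[OF has_derivative_linear[OF hd]] by simp
    then show "((\<lambda>s. h (x + s *\<^sub>R b)) has_vector_derivative dir_deriv b h (x + s *\<^sub>R b)) (at s within ?U)"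
      using has_vector_derivative_at_within by blast
  next
    fix s :: real
    show "(\<lambda>x. h (x + s *\<^sub>R b)) integrable_on cell"
      by (intro integrable_continuous continuous_on_compose2[OF hc] continuous_intros) auto
  next
    show "continuous_on (?U \<times> cell) (\<lambda>(s, x). dir_deriv b h (x + s *\<^sub>R b))"
      unfolding split_beta
      by (intro continuous_on_compose2[OF cont] continuous_intros) auto
  qed auto
  moreover have "((\<lambda>s. integral cell (\<lambda>x. h (x + s *\<^sub>R b))) has_vector_derivative 0) (at 0 within ?U)"
  proof (rule has_vector_derivative_transform[where f = "\<lambda>s. integral cell h"])
    fix s :: real assume "s \<in> ?U"
    then have "0 \<le> s" "s \<le> 2 * pi" using pi_gt3 by auto
    then show "integral cell (\<lambda>x. h (x + s *\<^sub>R b)) = integral cell h"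
      by (rule integral_cell_shift[OF per hc b])
  qed auto
  ultimately have "integral cell (\<lambda>x. dir_deriv b h (x + 0 *\<^sub>R b)) = 0"
    by (rule vector_derivative_unique_within_closed_interval[rotated 2]) auto
  then show ?thesis by simp
qed

lemma dist_of_fun_wave: "dist_of_fun f (wave k) = integral cell (\<lambda>x. f x * wave k x)"
  by (simp add: dist_of_fun_def)

text \<open>Integration by parts: the product of \<open>f\<close> and the character has a partial derivative of integral zero.\<close>
lemma dist_of_fun_dir_deriv:
  assumes f: "f \<in> torus_smooth" and k: "k \<in> freqs" and b: "b \<in> Basis"
  shows "dist_of_fun (dir_deriv b f) (wave k) = - (\<i> * of_real (k \<bullet> b)) * dist_of_fun f (wave k)"
proof -
  define h where "h = (\<lambda>x. f x * wave k x)"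
  have hd: "(h has_derivative (\<lambda>v. f x * (\<i> * of_real (k \<bullet> v) * wave k x) +
      frechet_derivative f (at x) v * wave k x)) (at x)" for x
    unfolding h_def by (intro has_derivative_mult torus_smooth_has_derivative f wave_has_derivative)
  have dh: "dir_deriv b h = (\<lambda>x. \<i> * of_real (k \<bullet> b) * (f x * wave k x) + dir_deriv b f x * wave k x)"
    by (rule ext, subst dir_deriv_eqI[OF hd]) (simp add: dir_deriv_def)
  have cf: "continuous_on S f" "continuous_on S (dir_deriv b f)" for S
    using f b torus_smooth_dir_deriv torus_smooth_continuous by blast+
  have "integral cell (dir_deriv b h) = 0"
  proof (rule integral_dir_deriv_eq_0[OF _ _ _ b])
    show "torus_periodic h"
      using torus_smooth_periodic[OF f] torus_periodic_wave[OF k]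
      by (simp add: torus_periodic_def h_def)
    show "h differentiable (at x)" for x using hd differentiableI by blast
    show "continuous_on UNIV (dir_deriv b h)"
      unfolding dh by (intro continuous_intros cf)
  qed
  also have "integral cell (dir_deriv b h) =
      \<i> * of_real (k \<bullet> b) * dist_of_fun f (wave k) + dist_of_fun (dir_deriv b f) (wave k)"
    unfolding dh dist_of_fun_wave
    by (subst integral_add) (auto intro!: integrable_continuous continuous_intros cf)
  finally show ?thesis by (simp add: algebra_simps eq_neg_iff_add_eq_0)
qed

lemma norm_dist_of_fun_iterated_partial:
  assumes f: "f \<in> torus_smooth" and k: "k \<in> freqs" and b: "b \<in> Basis"
  shows "norm (dist_of_fun (iter_partial (replicate N b) f) (wave k)) =
    \<bar>k \<bullet> b\<bar> ^ N * norm (dist_of_fun f (wave k))"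
proof (induction N)
  case (Suc N)
  have "iter_partial (replicate N b) f \<in> torus_smooth"
    using b by (intro torus_smooth_iter_partial[OF f]) auto
  then show ?case
    using Suc by (simp add: dist_of_fun_dir_deriv[OF _ k b] norm_mult)
qed simp

lemma norm_dist_of_fun_wave_le:
  assumes f: "f \<in> torus_smooth" and "\<And>x. x \<in> cell \<Longrightarrow> norm (f x) \<le> e"
  shows "norm (dist_of_fun f (wave (k::'a::euclidean_space))) \<le> e * measure lborel (cell :: 'a set)"
proof (rule has_integral_bound)
  show "0 \<le> e" using assms(2)[OF zero_in_cell] norm_ge_zero[of "f 0"] by linarith
  show "((\<lambda>x. f x * wave k x) has_integral dist_of_fun f (wave k)) cell"
    unfolding dist_of_fun_wave using torus_smooth_continuous[OF f]
    by (intro integrable_integral integrable_continuous continuous_intros)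
qed (simp add: norm_mult assms)

text \<open>The largest coordinate of \<open>k\<close> controls \<open>weight k\<close>, and integrating by parts \<open>N\<close> times in that
direction gains its \<open>N\<close>-th power. The dependence on \<open>e\<close> is explicit because continuity of the
functional \<open>wave_sum_functional\<close> needs a bound that is uniform in \<open>f\<close>.\<close>
lemma wave_coefficient_bound:
  fixes k :: "'a::euclidean_space"
  assumes f: "f \<in> torus_smooth" and k: "k \<in> freqs"
    and e0: "\<And>x. x \<in> cell \<Longrightarrow> norm (f x) \<le> e"
    and eN: "\<And>x b. x \<in> cell \<Longrightarrow> b \<in> Basis \<Longrightarrow> norm (iter_partial (replicate N b) f x) \<le> e"
  shows "norm (dist_of_fun f (wave k)) * weight k ^ N
    \<le> (1 + real DIM('a)) ^ N * measure lborel (cell :: 'a set) * e"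
proof -
  let ?V = "measure lborel (cell :: 'a set)" and ?I = "norm (dist_of_fun f (wave k))"
  \<comment> \<open>The extra element 1 covers frequencies all of whose coordinates vanish.\<close>
  define M where "M = Max (insert 1 ((\<lambda>b. \<bar>k \<bullet> b\<bar>) ` Basis))"
  have M: "1 \<le> M" "\<And>b. b \<in> Basis \<Longrightarrow> \<bar>k \<bullet> b\<bar> \<le> M"
    by (auto simp: M_def simp del: Max_insert intro!: Max_ge)
  have "norm k \<le> (\<Sum>b\<in>Basis. \<bar>k \<bullet> b\<bar>)" by (rule norm_le_l1)
  also have "\<dots> \<le> (\<Sum>b\<in>(Basis::'a set). M)" using M by (intro sum_mono) auto
  finally have "weight k \<le> (1 + real DIM('a)) * M"
    using M(1) by (simp add: weight_def algebra_simps)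
  then have w: "weight k ^ N \<le> (1 + real DIM('a)) ^ N * M ^ N"
    by (metis power_mono power_mult_distrib weight_nonneg)
  have "M ^ N * ?I \<le> e * ?V"
  proof -
    have "M \<in> insert 1 ((\<lambda>b. \<bar>k \<bullet> b\<bar>) ` Basis)"
      unfolding M_def by (rule Max_in) auto
    then consider "M = 1" | b where "b \<in> Basis" "M = \<bar>k \<bullet> b\<bar>" by auto
    then show ?thesis
    proof cases
      case 1
      then show ?thesis using norm_dist_of_fun_wave_le[OF f e0, of k] by simp
    next
      case 2
      have "iter_partial (replicate N b) f \<in> torus_smooth"
        using 2 by (intro torus_smooth_iter_partial[OF f]) auto
      from norm_dist_of_fun_wave_le[OF this eN, of k] show ?thesis
        using 2 norm_dist_of_fun_iterated_partial[OF f k] by simp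
    qed
  qed
  then have "(1 + real DIM('a)) ^ N * (M ^ N * ?I) \<le> (1 + real DIM('a)) ^ N * (e * ?V)"
    by (intro mult_left_mono) auto
  moreover have "?I * weight k ^ N \<le> ?I * ((1 + real DIM('a)) ^ N * M ^ N)"
    using w by (intro mult_left_mono) auto
  ultimately show ?thesis by (simp only: mult_ac)
qed

lemma wave_coefficients_decay:
  fixes f :: "'a::euclidean_space \<Rightarrow> complex"
  assumes f: "f \<in> torus_smooth"
  shows "\<exists>C\<ge>0. \<forall>k\<in>freqs. norm (dist_of_fun f (wave k)) * weight k ^ N \<le> C"
proof -
  have bdd: "\<exists>B. \<forall>x\<in>cell. norm (g x) \<le> B" if "g \<in> torus_smooth" for g :: "'a \<Rightarrow> complex"
  proof -
    have "compact (g ` cell)"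
      using torus_smooth_continuous[OF that] by (intro compact_continuous_image) auto
    then show ?thesis using compact_imp_bounded bounded_iff by (metis imageI)
  qed
  have "\<exists>B. \<forall>x\<in>cell. norm (iter_partial (replicate N b) f x) \<le> B" if "b \<in> Basis" for b
    using that by (intro bdd torus_smooth_iter_partial[OF f]) auto
  then obtain B where B: "\<And>x b. b \<in> Basis \<Longrightarrow> x \<in> cell \<Longrightarrow> norm (iter_partial (replicate N b) f x) \<le> B b"
    by metis
  obtain B0 where B0: "\<And>x. x \<in> cell \<Longrightarrow> norm (f x) \<le> B0" using bdd[OF f] by blast
  define e where "e = Max (insert B0 (B ` Basis))"
  have e: "B0 \<le> e" "\<And>b. b \<in> Basis \<Longrightarrow> B b \<le> e" by (auto simp: e_def simp del: Max_insert intro!: Max_ge)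
  have "0 \<le> e" using B0[OF zero_in_cell] e(1) norm_ge_zero[of "f 0"] by linarith
  then have "0 \<le> (1 + real DIM('a)) ^ N * measure lborel (cell :: 'a set) * e" by simp
  then show ?thesis
    using wave_coefficient_bound[OF f _ order_trans[OF B0 e(1)] order_trans[OF B e(2)]] by blast
qed

text \<open>For \<open>k \<noteq> 0\<close> integrate the constant function by parts in a direction with \<open>k \<bullet> b \<noteq> 0\<close>.\<close>
lemma integral_wave:
  fixes k :: "'a::euclidean_space"
  assumes k: "k \<in> freqs"
  shows "integral cell (wave k) = (if k = 0 then of_real (measure lborel (cell :: 'a set)) else 0)"
proof (cases "k = 0")
  case True
  then show ?thesis by (simp add: wave_def[abs_def] scaleR_conv_of_real)
next
  case False
  then obtain b where b: "b \<in> Basis" "k \<bullet> b \<noteq> 0" using euclidean_all_zero_iff by blast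
  have one: "(\<lambda>x::'a. 1 :: complex) \<in> torus_smooth"
    using wave_smooth[OF freqs_zero] by (simp add: wave_def[abs_def])
  have "dir_deriv b (\<lambda>x::'a. 1 :: complex) = (\<lambda>x. 0)"
    by (rule ext) (rule dir_deriv_eqI, auto)
  then have "0 = - (\<i> * of_real (k \<bullet> b)) * integral cell (wave k)"
    using dist_of_fun_dir_deriv[OF one k b(1)] by (simp add: dist_of_fun_wave)
  then show ?thesis using b False by simp
qed

section \<open>Uniqueness of Fourier coefficients\<close>

lemma torus_periodic_lattice:
  fixes f :: "'a::euclidean_space \<Rightarrow> 'b"
  assumes per: "torus_periodic f" and k: "k \<in> freqs"
  shows "f (x + (2 * pi) *\<^sub>R k) = f x"
proof -
  have nat: "f (x + (2 * pi * real n) *\<^sub>R b) = f x" if "b \<in> Basis" for n b x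
  proof (induction n)
    case (Suc n)
    have "x + (2 * pi * real (Suc n)) *\<^sub>R b = (x + (2 * pi * real n) *\<^sub>R b) + (2 * pi) *\<^sub>R b"
      by (simp add: algebra_simps)
    then show ?case using Suc per that unfolding torus_periodic_def by metis
  qed simp
  have int: "f (x + (2 * pi * of_int m) *\<^sub>R b) = f x" if "b \<in> Basis" for m b x
  proof (cases "0 \<le> m")
    case True
    then show ?thesis using nat[OF that, of x "nat m"] by simp
  next
    case False
    then show ?thesis using nat[OF that, of "x + (2 * pi * of_int m) *\<^sub>R b" "nat (- m)"] by simp
  qed
  have "f (x + (\<Sum>b\<in>A. (2 * pi * (k \<bullet> b)) *\<^sub>R b)) = f x" if "finite A" "A \<subseteq> Basis" for A
    using that
  proof (induction A)
    case (insert b A)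
    have "k \<bullet> b \<in> \<int>" using k insert.prems by (auto simp: freqs_def)
    then obtain m where "k \<bullet> b = of_int m" by (rule Ints_cases)
    then show ?case
      using insert int[of b "x + (\<Sum>b\<in>A. (2 * pi * (k \<bullet> b)) *\<^sub>R b)" m] by (simp add: add_ac)
  qed simp
  from this[of Basis] have "f (x + (2 * pi) *\<^sub>R (\<Sum>b\<in>Basis. (k \<bullet> b) *\<^sub>R b)) = f x"
    by (simp add: scaleR_sum_right del: euclidean_representation)
  then show ?thesis by (simp only: euclidean_representation)
qed

text \<open>Realises the torus as a compact subset of a Euclidean space, where polynomials restrict to
trigonometric polynomials.\<close>
definition torus_embedding :: "'a::euclidean_space \<Rightarrow> 'a \<times> 'a" where
  "torus_embedding x = (\<Sum>b\<in>Basis. cos (x \<bullet> b) *\<^sub>R b, \<Sum>b\<in>Basis. sin (x \<bullet> b) *\<^sub>R b)"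

lemma continuous_on_torus_embedding: "continuous_on S torus_embedding"
  unfolding torus_embedding_def[abs_def] by (intro continuous_intros)

lemma torus_embedding_fibre:
  assumes per: "torus_periodic f" and eq: "torus_embedding x = torus_embedding y"
  shows "f x = f y"
proof -
  have "\<exists>m::int. x \<bullet> b = y \<bullet> b + 2 * pi * of_int m" if "b \<in> Basis" for b
  proof -
    have "cos (x \<bullet> b) = fst (torus_embedding x) \<bullet> b" "sin (x \<bullet> b) = snd (torus_embedding x) \<bullet> b"
      "cos (y \<bullet> b) = fst (torus_embedding y) \<bullet> b" "sin (y \<bullet> b) = snd (torus_embedding y) \<bullet> b"
      using that by (simp_all add: torus_embedding_def)
    then show ?thesis using sin_cos_eq_iff eq by metis
  qed
  then have "(1 / (2 * pi)) *\<^sub>R (x - y) \<in> freqs"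
    unfolding freqs_def by (fastforce simp: inner_diff_left)
  from torus_periodic_lattice[OF per this, of y] show ?thesis by simp
qed

text \<open>The vanishing of all coefficients is stable under multiplication by characters. This is what lets
it pass, by induction over polynomials, to orthogonality against all trigonometric polynomials
without ever writing these as explicit sums.\<close>
definition null_coefficients :: "('a::euclidean_space \<Rightarrow> complex) \<Rightarrow> bool" where
  "null_coefficients g \<longleftrightarrow> continuous_on UNIV g \<and> (\<forall>k\<in>freqs. integral cell (\<lambda>x. g x * wave k x) = 0)"

lemma null_coefficients_continuous: "null_coefficients g \<Longrightarrow> continuous_on S g"
  unfolding null_coefficients_def using continuous_on_subset by blast

lemma null_coefficientsD:
  "null_coefficients g \<Longrightarrow> k \<in> freqs \<Longrightarrow> integral cell (\<lambda>x. g x * wave k x) = 0"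
  by (simp add: null_coefficients_def)

lemma null_coefficientsI:
  assumes "continuous_on UNIV g" "\<And>k. k \<in> freqs \<Longrightarrow> integral cell (\<lambda>x. g x * wave k x) = 0"
  shows "null_coefficients g"
  using assms by (simp add: null_coefficients_def)

lemma null_coefficients_integrable:
  "null_coefficients g \<Longrightarrow> (\<lambda>x. g x * wave k x) integrable_on cell"
  by (intro integrable_continuous continuous_intros null_coefficients_continuous)

lemma null_coefficients_add:
  assumes f: "null_coefficients f" and g: "null_coefficients g"
  shows "null_coefficients (\<lambda>x. f x + g x)"
proof (rule null_coefficientsI)
  show "continuous_on UNIV (\<lambda>x. f x + g x)"
    by (intro continuous_on_add null_coefficients_continuous f g)
  show "integral cell (\<lambda>x. (f x + g x) * wave k x) = 0" if "k \<in> freqs" for k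
    unfolding distrib_right
    by (subst integral_add) (simp_all add: null_coefficients_integrable null_coefficientsD f g that)
qed

lemma null_coefficients_cmult:
  assumes f: "null_coefficients f"
  shows "null_coefficients (\<lambda>x. c * f x)"
proof (rule null_coefficientsI)
  show "continuous_on UNIV (\<lambda>x. c * f x)"
    by (intro continuous_on_mult_left null_coefficients_continuous f)
  show "integral cell (\<lambda>x. c * f x * wave k x) = 0" if "k \<in> freqs" for k
    by (simp add: mult.assoc null_coefficientsD f that)
qed

lemma null_coefficients_mult_wave:
  assumes "null_coefficients f" "l \<in> freqs"
  shows "null_coefficients (\<lambda>x. f x * wave l x)"
proof (rule null_coefficientsI)
  show "continuous_on UNIV (\<lambda>x. f x * wave l x)"
    by (intro continuous_on_mult continuous_on_wave null_coefficients_continuous assms)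
  show "integral cell (\<lambda>x. f x * wave l x * wave k x) = 0" if "k \<in> freqs" for k
    using null_coefficientsD[OF assms(1) freqs_add[OF assms(2) that]]
    by (simp add: wave_add mult.assoc)
qed

lemma null_coefficients_sum:
  assumes "finite A" "\<And>i. i \<in> A \<Longrightarrow> null_coefficients (f i)"
  shows "null_coefficients (\<lambda>x. \<Sum>i\<in>A. f i x)"
  using assms
proof (induction A rule: finite_induct)
  case empty
  then show ?case by (simp add: null_coefficients_def)
next
  case (insert i A)
  then show ?case using null_coefficients_add[of "f i"] by simp
qed

lemma null_coefficients_mult_cos_sin:
  assumes g: "null_coefficients g" and b: "b \<in> Basis"
  shows "null_coefficients (\<lambda>x. g x * of_real (cos (x \<bullet> b)))"
    and "null_coefficients (\<lambda>x. g x * of_real (sin (x \<bullet> b)))"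
proof -
  have w: "null_coefficients (\<lambda>x. g x * wave b x)" "null_coefficients (\<lambda>x. g x * wave (- b) x)"
    using freqs_Basis[OF b] by (auto intro!: null_coefficients_mult_wave[OF g])
  have "null_coefficients (\<lambda>x. (1 / 2) * (g x * wave b x) + (1 / 2) * (g x * wave (- b) x))"
    by (intro null_coefficients_add null_coefficients_cmult w)
  also have "(\<lambda>x. (1 / 2) * (g x * wave b x) + (1 / 2) * (g x * wave (- b) x)) =
      (\<lambda>x. g x * of_real (cos (x \<bullet> b)))"
    by (rule ext) (simp add: wave_def complex_eq_iff inner_commute field_simps)
  finally show "null_coefficients (\<lambda>x. g x * of_real (cos (x \<bullet> b)))" .
  have "null_coefficients (\<lambda>x. (- \<i> / 2) * (g x * wave b x) + (\<i> / 2) * (g x * wave (- b) x))"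
    by (intro null_coefficients_add null_coefficients_cmult w)
  also have "(\<lambda>x. (- \<i> / 2) * (g x * wave b x) + (\<i> / 2) * (g x * wave (- b) x)) =
      (\<lambda>x. g x * of_real (sin (x \<bullet> b)))"
    by (rule ext) (simp add: wave_def complex_eq_iff inner_commute field_simps)
  finally show "null_coefficients (\<lambda>x. g x * of_real (sin (x \<bullet> b)))" .
qed

lemma null_coefficients_mult_polynomial:
  fixes q :: "'a::euclidean_space \<times> 'a \<Rightarrow> real"
  assumes "real_polynomial_function q" "null_coefficients g"
  shows "null_coefficients (\<lambda>x. g x * of_real (q (torus_embedding x)))"
  using assms
proof (induction q arbitrary: g rule: real_polynomial_function.induct)
  case (linear q)
  interpret q: bounded_linear q by (rule linear.hyps)
  have eq: "q (torus_embedding x) =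
      (\<Sum>b\<in>Basis. cos (x \<bullet> b) * q (b, 0)) + (\<Sum>b\<in>Basis. sin (x \<bullet> b) * q (0, b))" for x
  proof -
    have "torus_embedding x = (\<Sum>b\<in>Basis. cos (x \<bullet> b) *\<^sub>R (b, 0)) + (\<Sum>b\<in>Basis. sin (x \<bullet> b) *\<^sub>R (0, b))"
      by (simp add: torus_embedding_def prod_eq_iff fst_sum snd_sum)
    then show ?thesis by (simp only: q.add q.sum q.scaleR real_scaleR_def)
  qed
  have "null_coefficients (\<lambda>x. (\<Sum>b\<in>Basis. of_real (q (b, 0)) * (g x * of_real (cos (x \<bullet> b)))) +
      (\<Sum>b\<in>Basis. of_real (q (0, b)) * (g x * of_real (sin (x \<bullet> b)))))"
    by (intro null_coefficients_add null_coefficients_sum null_coefficients_cmult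
        null_coefficients_mult_cos_sin linear.prems) auto
  also have "(\<lambda>x. (\<Sum>b\<in>Basis. of_real (q (b, 0)) * (g x * of_real (cos (x \<bullet> b)))) +
      (\<Sum>b\<in>Basis. of_real (q (0, b)) * (g x * of_real (sin (x \<bullet> b))))) =
      (\<lambda>x. g x * of_real (q (torus_embedding x)))"
    by (auto simp: eq sum_distrib_left distrib_left mult_ac)
  finally show ?case .
next
  case (const c)
  then show ?case using null_coefficients_cmult[of g "of_real c"] by (simp add: mult.commute)
next
  case (add q r)
  then show ?case
    using null_coefficients_add[OF add.IH(1)[OF add.prems] add.IH(2)[OF add.prems]]
    by (simp add: distrib_left)
next
  case (mult q r)
  then show ?case by (metis (no_types, lifting) mult.assoc of_real_mult ext)
qed

text \<open>A continuous periodic function factors through the embedding, and the factor is continuous because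
a continuous map from a compact space is a quotient map onto its image; Stone--Weierstrass applies
to that factor.\<close>
lemma torus_polynomial_approximation:
  fixes r :: "'a::euclidean_space \<Rightarrow> real"
  assumes per: "torus_periodic r" and cont: "continuous_on UNIV r" and e: "e > 0"
  obtains q where "real_polynomial_function q" "\<And>x. x \<in> cell \<Longrightarrow> \<bar>r x - q (torus_embedding x)\<bar> < e"
proof -
  let ?K = "torus_embedding ` (cell :: 'a set)"
  have cell: "compact (cell :: 'a set)" by simp
  define G where "G z = r (SOME x. x \<in> cell \<and> torus_embedding x = z)" for z
  have G: "G (torus_embedding x) = r x" if "x \<in> cell" for x
  proof -
    have "\<exists>y. y \<in> cell \<and> torus_embedding y = torus_embedding x" using that by blast
    then show ?thesis
      unfolding G_def by (metis (mono_tags, lifting) someI_ex torus_embedding_fibre[OF per])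
  qed
  have "continuous_on ?K G"
    unfolding continuous_openin_preimage_eq
  proof (intro allI impI)
    fix T :: "real set" assume T: "open T"
    have "cell \<inter> torus_embedding -` (?K \<inter> G -` T) = cell \<inter> r -` T"
    proof (rule set_eqI)
      fix x show "x \<in> cell \<inter> torus_embedding -` (?K \<inter> G -` T) \<longleftrightarrow> x \<in> cell \<inter> r -` T"
        using G[of x] by (cases "x \<in> cell") simp_all
    qed
    then have "openin (top_of_set cell) (cell \<inter> torus_embedding -` (?K \<inter> G -` T))"
      using continuous_openin_preimage_eq[of cell r] continuous_on_subset[OF cont] T by auto
    then show "openin (top_of_set ?K) (?K \<inter> G -` T)"
      using Abstract_Topology_2.continuous_imp_quotient_map[OF continuous_on_torus_embedding
          refl cell Int_lower1[of ?K "G -` T"]] by (rule rev_iffD1)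
  qed
  moreover have "compact ?K"
    by (intro compact_continuous_image continuous_on_torus_embedding cell)
  ultimately obtain q where "real_polynomial_function q" "\<And>z. z \<in> ?K \<Longrightarrow> \<bar>G z - q z\<bar> < e"
    using Stone_Weierstrass_real_polynomial_function e by metis
  then show thesis using G that by (metis imageI)
qed

text \<open>If \<open>q\<close> approximates \<open>r\<close> uniformly within \<open>d\<close>, then \<open>\<integral> r\<^sup>2 = \<integral> r (r - q)\<close> is at most a constant
times \<open>d\<close>, so \<open>\<integral> r\<^sup>2 = 0\<close>.\<close>
lemma orthogonal_to_polynomials_imp_zero:
  fixes r :: "'a::euclidean_space \<Rightarrow> real"
  assumes per: "torus_periodic r" and cont: "continuous_on UNIV r"
    and orth: "\<And>q. real_polynomial_function q \<Longrightarrow> integral cell (\<lambda>x. r x * q (torus_embedding x)) = 0"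
    and x: "x \<in> cell"
  shows "r x = 0"
proof -
  let ?V = "measure lborel (cell :: 'a set)"
  have rc: "continuous_on cell r" using cont continuous_on_subset by blast
  have "compact (r ` cell)" using rc by (intro compact_continuous_image) auto
  then obtain B where B: "\<And>x. x \<in> cell \<Longrightarrow> \<bar>r x\<bar> \<le> B"
    using compact_imp_bounded bounded_iff by (metis imageI real_norm_def)
  have B0: "0 \<le> B" using B[OF zero_in_cell] by linarith
  have "integral cell (\<lambda>x. r x * r x) \<le> 0 + e" if e: "e > 0" for e
  proof -
    define d where "d = e / (B * ?V + 1)"
    have BV: "0 \<le> B * ?V" using B0 by simp
    then have d: "d > 0" using e by (simp add: d_def add_nonneg_pos)
    obtain q where q: "real_polynomial_function q"
      "\<And>x. x \<in> cell \<Longrightarrow> \<bar>r x - q (torus_embedding x)\<bar> < d"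
      using torus_polynomial_approximation[OF per cont d] by metis
    have qc: "continuous_on cell (\<lambda>x. q (torus_embedding x))"
      using continuous_on_compose2[OF _ continuous_on_torus_embedding, of UNIV q] q(1)
      by (simp add: continuous_on_polymonial_function real_polynomial_function_eq)
    have i: "(\<lambda>x. r x * r x) integrable_on cell" "(\<lambda>x. r x * q (torus_embedding x)) integrable_on cell"
      by (intro integrable_continuous continuous_intros rc qc)+
    have hi: "((\<lambda>x. r x * (r x - q (torus_embedding x))) has_integral integral cell (\<lambda>x. r x * r x)) cell"
      using has_integral_diff[OF i[THEN integrable_integral]] orth[OF q(1)]
      by (simp add: right_diff_distrib)
    have "norm (integral cell (\<lambda>x. r x * r x)) \<le> (B * d) * ?V"
    proof (rule has_integral_bound[OF _ hi])
      show "0 \<le> B * d" using B0 d by simp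
      show "norm (r x * (r x - q (torus_embedding x))) \<le> B * d" if "x \<in> cell" for x
        using B[OF that] q(2)[OF that] B0 by (simp add: abs_mult mult_mono)
    qed
    also have "\<dots> = (B * ?V) * d" by simp
    also have "\<dots> \<le> e" using BV e unfolding d_def by (simp add: divide_le_eq add_nonneg_pos algebra_simps)
    finally show ?thesis by simp
  qed
  then have "integral cell (\<lambda>x. r x * r x) \<le> 0" by (rule field_le_epsilon)
  moreover have "0 \<le> integral cell (\<lambda>x. r x * r x)"
    by (intro integral_nonneg integrable_continuous continuous_intros rc) auto
  ultimately have "integral cell (\<lambda>x. r x * r x) = 0" by linarith
  moreover have "continuous_on cell (\<lambda>x. r x * r x)"
    by (intro continuous_on_mult rc)
  ultimately have "\<forall>x\<in>cell. r x * r x = 0"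
    using integral_cbox_eq_0_iff[OF _ box_cell_nonempty, of "\<lambda>x. r x * r x"] by simp
  then show ?thesis using x by simp
qed

text \<open>Real and imaginary parts are treated separately since the approximating polynomials are real;
the values off the fundamental cell follow by periodicity.\<close>
lemma null_coefficients_imp_zero:
  fixes g :: "'a::euclidean_space \<Rightarrow> complex"
  assumes per: "torus_periodic g" and null: "null_coefficients g"
  shows "g x = 0"
proof -
  have cont: "continuous_on UNIV g" using null by (simp add: null_coefficients_def)
  have cell0: "g y = 0" if y: "y \<in> cell" for y
  proof -
    have orth: "integral cell (\<lambda>x. g x * of_real (q (torus_embedding x))) = 0"
      and int: "(\<lambda>x. g x * of_real (q (torus_embedding x))) integrable_on cell"
      if "real_polynomial_function q" for q
      using null_coefficients_mult_polynomial[OF that null]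
        null_coefficients_integrable[OF null_coefficients_mult_polynomial[OF that null], of 0]
      unfolding null_coefficients_def by (auto dest!: bspec[OF _ freqs_zero])
    have "Re (g y) = 0"
    proof (rule orthogonal_to_polynomials_imp_zero[OF _ _ _ y])
      show "integral cell (\<lambda>x. Re (g x) * q (torus_embedding x)) = 0" if "real_polynomial_function q" for q
        using integral_linear[OF int[OF that] bounded_linear_Re] orth[OF that] by (simp add: o_def)
      show "torus_periodic (\<lambda>x. Re (g x))" using per unfolding torus_periodic_def by metis
      show "continuous_on UNIV (\<lambda>x. Re (g x))" by (intro continuous_intros cont)
    qed
    moreover have "Im (g y) = 0"
    proof (rule orthogonal_to_polynomials_imp_zero[OF _ _ _ y])
      show "integral cell (\<lambda>x. Im (g x) * q (torus_embedding x)) = 0" if "real_polynomial_function q" for q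
        using integral_linear[OF int[OF that] bounded_linear_Im] orth[OF that] by (simp add: o_def)
      show "torus_periodic (\<lambda>x. Im (g x))" using per unfolding torus_periodic_def by metis
      show "continuous_on UNIV (\<lambda>x. Im (g x))" by (intro continuous_intros cont)
    qed
    ultimately show ?thesis by (simp add: complex_eq_iff)
  qed
  define k where "k = (\<Sum>b\<in>Basis. of_int (- \<lfloor>x \<bullet> b / (2 * pi)\<rfloor>) *\<^sub>R b)"
  have kb: "k \<bullet> b = - of_int \<lfloor>x \<bullet> b / (2 * pi)\<rfloor>" if "b \<in> Basis" for b
    using that unfolding k_def by (simp only: inner_sum_left_Basis of_int_minus)
  have "k \<in> freqs" by (simp add: freqs_def kb)
  moreover have "x + (2 * pi) *\<^sub>R k \<in> cell"
    unfolding cell_iff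
  proof
    fix b :: 'a assume b: "b \<in> Basis"
    let ?y = "x \<bullet> b / (2 * pi)"
    have "(x + (2 * pi) *\<^sub>R k) \<bullet> b = 2 * pi * (?y - of_int \<lfloor>?y\<rfloor>)"
      by (simp add: inner_add_left kb[OF b] field_simps)
    moreover have "0 \<le> ?y - of_int \<lfloor>?y\<rfloor>" "?y - of_int \<lfloor>?y\<rfloor> \<le> 1"
      by (simp_all, linarith)
    ultimately show "0 \<le> (x + (2 * pi) *\<^sub>R k) \<bullet> b \<and> (x + (2 * pi) *\<^sub>R k) \<bullet> b \<le> 2 * pi"
      by simp
  qed
  ultimately show ?thesis using cell0 torus_periodic_lattice[OF per] by metis
qed

section \<open>Fourier inversion\<close>

lemma dist_of_fun_wave_series:
  fixes k :: "nat \<Rightarrow> 'a::euclidean_space"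
  assumes summ: "summable (\<lambda>n. norm (c n))" and \<phi>: "continuous_on UNIV \<phi>"
  shows "(\<lambda>n. c n * dist_of_fun \<phi> (wave (k n))) sums dist_of_fun (\<lambda>x. \<Sum>n. c n * wave (k n) x) \<phi>"
proof -
  have \<phi>c: "continuous_on cell \<phi>" using \<phi> continuous_on_subset by blast
  have "compact (\<phi> ` cell)" using \<phi>c by (intro compact_continuous_image) auto
  then obtain B where B: "\<And>x. x \<in> cell \<Longrightarrow> norm (\<phi> x) \<le> B"
    using compact_imp_bounded bounded_iff by (metis imageI)
  have "uniform_limit cell (\<lambda>N x. \<Sum>n<N. c n * wave (k n) x * \<phi> x)
      (\<lambda>x. \<Sum>n. c n * wave (k n) x * \<phi> x) sequentially"
  proof (rule Weierstrass_m_test)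
    show "summable (\<lambda>n. norm (c n) * B)" using summ by (rule summable_mult2)
  qed (auto simp: norm_mult intro!: mult_left_mono B)
  then obtain I J where IJ: "\<And>N. ((\<lambda>x. \<Sum>n<N. c n * wave (k n) x * \<phi> x) has_integral I N) cell"
    "((\<lambda>x. \<Sum>n. c n * wave (k n) x * \<phi> x) has_integral J) cell" "I \<longlonglongrightarrow> J"
    by (rule uniform_limit_integral_cbox) (auto intro!: continuous_intros \<phi>c)
  have "I = (\<lambda>N. \<Sum>n<N. c n * dist_of_fun \<phi> (wave (k n)))"
  proof (rule ext, rule has_integral_unique[OF IJ(1)])
    fix N
    have "((\<lambda>x. c n * wave (k n) x * \<phi> x) has_integral c n * dist_of_fun \<phi> (wave (k n))) cell" for n
    proof -
      have "(\<lambda>x. \<phi> x * wave (k n) x) integrable_on cell"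
        by (intro integrable_continuous continuous_intros \<phi>c)
      from has_integral_mult_right[OF integrable_integral[OF this], of "c n"] show ?thesis
        by (simp add: dist_of_fun_wave mult_ac)
    qed
    then show "((\<lambda>x. \<Sum>n<N. c n * wave (k n) x * \<phi> x) has_integral
        (\<Sum>n<N. c n * dist_of_fun \<phi> (wave (k n)))) cell"
      by (intro has_integral_sum) auto
  qed
  moreover have "J = dist_of_fun (\<lambda>x. \<Sum>n. c n * wave (k n) x) \<phi>"
  proof -
    have "summable (\<lambda>n. c n * wave (k n) x)" for x
      by (rule summable_norm_cancel) (simp add: norm_mult summ)
    then have "(\<Sum>n. c n * wave (k n) x * \<phi> x) = (\<Sum>n. c n * wave (k n) x) * \<phi> x" for x
      by (rule suminf_mult2[symmetric])
    then show ?thesis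
      using IJ(2) by (simp add: dist_of_fun_def integral_unique)
  qed
  ultimately show ?thesis using IJ(3) by (simp add: sums_def)
qed

lemma iter_partial_sum:
  assumes "finite A" "\<And>i. i \<in> A \<Longrightarrow> f i \<in> torus_smooth" "set bs \<subseteq> Basis"
  shows "iter_partial bs (\<lambda>x. \<Sum>i\<in>A. f i x) = (\<lambda>x. \<Sum>i\<in>A. iter_partial bs (f i) x)"
  using assms
proof (induction A rule: finite_induct)
  case empty
  then show ?case using iter_partial_cmult[OF torus_smooth_zero, of bs 0] by simp
next
  case (insert i A)
  then show ?case
    using iter_partial_add[of "f i" "\<lambda>x. \<Sum>i\<in>A. f i x" bs] torus_smooth_sum[of A f] by auto
qed

lemma freqs_enumeration: "\<exists>k :: nat \<Rightarrow> 'a::euclidean_space. inj k \<and> range k = freqs"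
proof -
  have "countable (PiE (Basis :: 'a set) (\<lambda>_. UNIV :: int set))"
    by (rule countable_PiE) auto
  then have "countable (freq_coords ` (freqs :: 'a set))"
    by (rule countable_subset[rotated]) (auto simp: freq_coords_def)
  then have "countable (freqs :: 'a set)"
    using countable_image_inj_on inj_on_freq_coords by blast
  moreover have "infinite (freqs :: 'a set)"
  proof -
    obtain b :: 'a where b: "b \<in> Basis" by fastforce
    have "(\<lambda>n. real n *\<^sub>R b) ` UNIV \<subseteq> freqs"
      using b by (auto simp: freqs_def inner_Basis)
    moreover have "inj (\<lambda>n. real n *\<^sub>R b)" using b by (auto simp: inj_on_def)
    ultimately show ?thesis using finite_subset finite_imageD infinite_UNIV_nat by metis
  qed
  ultimately show ?thesis
    using bij_betw_from_nat_into[of "freqs :: 'a set"] by (auto simp: bij_betw_def)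
qed

lemma torus_smooth_wave_integrable:
  "f \<in> torus_smooth \<Longrightarrow> (\<lambda>x. f x * wave k x) integrable_on cell"
  by (intro integrable_continuous continuous_intros torus_smooth_continuous)

text \<open>The series of \<open>f\<close> converges to a smooth function with the same coefficients as \<open>f\<close>, hence to \<open>f\<close>
itself. All partial derivatives of the partial sums converge uniformly by the Weierstrass test,
since differentiation only multiplies the coefficients by polynomially growing factors.\<close>
lemma fourier_inversion:
  fixes f :: "'a::euclidean_space \<Rightarrow> complex" and k :: "nat \<Rightarrow> 'a"
  assumes f: "f \<in> torus_smooth" and k: "inj k" "range k = freqs"
  defines "a \<equiv> \<lambda>n. dist_of_fun f (wave (- k n)) / of_real (measure lborel (cell :: 'a set))"
  shows "rapidly_decaying k a" and "f = (\<lambda>x. \<Sum>n. a n * wave (k n) x)"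
    and "torus_smooth_tendsto (\<lambda>N x. \<Sum>n<N. a n * wave (k n) x) f"
proof -
  define V where "V = measure lborel (cell :: 'a set)"
  have V: "V > 0" unfolding V_def by (rule volume_cell_pos)
  have a_def: "a n = dist_of_fun f (wave (- k n)) / of_real V" for n
    by (simp only: a_def V_def)
  have kf: "k n \<in> freqs" for n using k(2) by blast
  show rd: "rapidly_decaying k a"
    unfolding rapidly_decaying_def
  proof
    fix N
    obtain C where C: "\<And>l. l \<in> freqs \<Longrightarrow> norm (dist_of_fun f (wave l)) * weight l ^ N \<le> C"
      using wave_coefficients_decay[OF f] by blast
    have "norm (a n) * weight (k n) ^ N \<le> C / V" for n
      using C[of "- k n"] kf[of n] V by (simp add: a_def norm_divide divide_right_mono)
    then show "\<exists>C. \<forall>n. norm (a n) * weight (k n) ^ N \<le> C" by blast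
  qed
  have summ: "summable (\<lambda>n. norm (a n) * weight (k n) ^ N)" for N
    using rapidly_decaying_summable[OF k(1) _ rd] k(2) by simp
  define S where "S = (\<lambda>x. \<Sum>n. a n * wave (k n) x)"
  have Ss: "S \<in> torus_smooth"
    unfolding S_def using wave_series_smooth[OF k(1) _ rd] k(2) by simp
  have "dist_of_fun S (wave l) = dist_of_fun f (wave l)" if l: "l \<in> freqs" for l
  proof -
    obtain m where m: "k m = - l" using k(2) l by (metis freqs_minus_iff imageE)
    have "a n * dist_of_fun (wave l) (wave (k n)) = (if n = m then dist_of_fun f (wave l) else 0)" for n
    proof -
      have "dist_of_fun (wave l) (wave (k n)) = integral cell (wave (l + k n))"
        by (simp add: dist_of_fun_wave wave_add[abs_def])
      also have "\<dots> = (if l + k n = 0 then of_real V else 0)"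
        using integral_wave[OF freqs_add[OF l kf]] by (simp only: V_def)
      also have "l + k n = 0 \<longleftrightarrow> n = m"
        using m k(1) by (metis add.inverse_inverse add_eq_0_iff2 injD minus_unique)
      finally have "a n * dist_of_fun (wave l) (wave (k n)) = (if n = m then a m * of_real V else 0)" by simp
      also have "a m * of_real V = dist_of_fun f (wave l)" using V m by (simp add: a_def)
      finally show ?thesis .
    qed
    moreover have "(\<lambda>n. a n * dist_of_fun (wave l) (wave (k n))) sums dist_of_fun S (wave l)"
      unfolding S_def using summ[of 0] by (intro dist_of_fun_wave_series continuous_intros) auto
    ultimately show ?thesis
      using sums_single[of m "\<lambda>_. dist_of_fun f (wave l)"] sums_unique2 by auto
  qed
  then have "integral cell (\<lambda>x. (f x - S x) * wave l x) = 0" if "l \<in> freqs" for l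
    using that unfolding left_diff_distrib dist_of_fun_wave
    by (subst integral_diff) (auto intro!: torus_smooth_wave_integrable f Ss)
  then have "null_coefficients (\<lambda>x. f x - S x)"
    unfolding null_coefficients_def
    using continuous_on_diff[OF torus_smooth_continuous[OF f] torus_smooth_continuous[OF Ss]] by blast
  moreover have "torus_periodic (\<lambda>x. f x - S x)"
    using torus_smooth_periodic[OF f] torus_smooth_periodic[OF Ss]
    unfolding torus_periodic_def by metis
  ultimately have "f x - S x = 0" for x
    using null_coefficients_imp_zero by blast
  then have "f = S" by auto
  then show fS: "f = (\<lambda>x. \<Sum>n. a n * wave (k n) x)" by (simp only: S_def)
  show "torus_smooth_tendsto (\<lambda>N x. \<Sum>n<N. a n * wave (k n) x) f"
    unfolding torus_smooth_tendsto_def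
  proof (intro allI impI)
    fix bs :: "'a list" assume bs: "set bs \<subseteq> Basis"
    have "iter_partial bs f = (\<lambda>x. \<Sum>n. (a n * symbol_of_partials bs (k n)) * wave (k n) x)"
      using iter_partial_wave_series[OF summ bs, THEN conjunct1] by (simp only: fS[symmetric])
    moreover have "iter_partial bs (\<lambda>x. \<Sum>n<N. a n * wave (k n) x) =
        (\<lambda>x. \<Sum>n<N. (a n * symbol_of_partials bs (k n)) * wave (k n) x)" for N
      using iter_partial_sum[of "{..<N}" "\<lambda>n x. a n * wave (k n) x" bs] wave_multiple_smooth[OF kf] bs
      by (simp add: iter_partial_wave_multiple[OF bs])
    moreover have "uniform_limit UNIV (\<lambda>N x. \<Sum>n<N. (a n * symbol_of_partials bs (k n)) * wave (k n) x)
        (\<lambda>x. \<Sum>n. (a n * symbol_of_partials bs (k n)) * wave (k n) x) sequentially"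
      by (rule Weierstrass_m_test[OF _ summ[of "length bs"]])
        (auto simp: norm_mult intro!: mult_left_mono norm_symbol_of_partials bs)
    ultimately show "uniform_limit UNIV (\<lambda>N. iter_partial bs (\<lambda>x. \<Sum>n<N. a n * wave (k n) x))
        (iter_partial bs f) sequentially" by simp
  qed
qed

section \<open>Distributions and a sufficient condition\<close>

lemma distribution_add:
  "torus_distribution u \<Longrightarrow> f \<in> torus_smooth \<Longrightarrow> g \<in> torus_smooth \<Longrightarrow> u (\<lambda>x. f x + g x) = u f + u g"
  by (simp add: torus_distribution_def)

lemma distribution_cmult:
  "torus_distribution u \<Longrightarrow> f \<in> torus_smooth \<Longrightarrow> u (\<lambda>x. c * f x) = c * u f"
  by (simp add: torus_distribution_def)

lemma distribution_zero: "torus_distribution u \<Longrightarrow> u (\<lambda>x. 0) = 0"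
  using distribution_cmult[OF _ torus_smooth_zero, of u 0] by simp

lemma distribution_sum:
  assumes u: "torus_distribution u" and "finite A" "\<And>i. i \<in> A \<Longrightarrow> f i \<in> torus_smooth"
  shows "u (\<lambda>x. \<Sum>i\<in>A. f i x) = (\<Sum>i\<in>A. u (f i))"
  using assms(2,3)
proof (induction A rule: finite_induct)
  case empty
  then show ?case using distribution_zero[OF u] by simp
next
  case (insert i A)
  then show ?case
    using distribution_add[OF u, of "f i" "\<lambda>x. \<Sum>i\<in>A. f i x"] torus_smooth_sum[of A f] by simp
qed

lemma distribution_tendsto:
  "torus_distribution u \<Longrightarrow> f \<in> torus_smooth \<Longrightarrow> (\<And>n. F n \<in> torus_smooth) \<Longrightarrow>
    torus_smooth_tendsto F f \<Longrightarrow> (\<lambda>n. u (F n)) \<longlonglongrightarrow> u f"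
  by (simp add: torus_distribution_def)

text \<open>Up to the volume of the cell, the density of \<open>u\<close> is the series of \<open>\<langle>u, wave k\<rangle> wave (- k)\<close>. Applying \<open>u\<close> to the partial sums of the
Fourier series of a test function, which converge in the smooth topology, shows that it represents
\<open>u\<close>; this is the only use of continuity of \<open>u\<close>.\<close>
lemma dist_is_smooth_if_decay:
  fixes u :: "'a::euclidean_space functional"
  assumes u: "torus_distribution u"
    and decay: "\<And>N. \<exists>C. \<forall>k\<in>freqs. norm (u (wave k)) * weight k ^ N \<le> C"
  shows "dist_is_smooth u"
proof -
  define V where "V = measure lborel (cell :: 'a set)"
  have V: "V > 0" unfolding V_def by (rule volume_cell_pos)
  obtain k :: "nat \<Rightarrow> 'a" where k: "inj k" "range k = freqs" using freqs_enumeration by blast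
  have kf: "k n \<in> freqs" for n using k(2) by blast
  define c where "c n = u (wave (k n)) / of_real V" for n
  have mk: "inj (\<lambda>n. - k n)" "range (\<lambda>n. - k n) \<subseteq> freqs"
    using k(1) kf by (auto simp: inj_on_def)
  have rd: "rapidly_decaying (\<lambda>n. - k n) c"
    unfolding rapidly_decaying_def
  proof
    fix N
    obtain C where C: "\<And>l. l \<in> freqs \<Longrightarrow> norm (u (wave l)) * weight l ^ N \<le> C"
      using decay by blast
    have "norm (c n) * weight (- k n) ^ N \<le> C / V" for n
      using C[OF kf[of n]] V by (simp add: c_def norm_divide divide_right_mono)
    then show "\<exists>C. \<forall>n. norm (c n) * weight (- k n) ^ N \<le> C" by blast
  qed
  define f where "f = (\<lambda>x. \<Sum>n. c n * wave (- k n) x)"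
  have f: "f \<in> torus_smooth"
    unfolding f_def by (rule wave_series_smooth[OF mk rd])
  have sc: "summable (\<lambda>n. norm (c n))"
    using rapidly_decaying_summable[OF mk rd, of 0] by simp
  have "u \<phi> = dist_of_fun f \<phi>" if \<phi>: "\<phi> \<in> torus_smooth" for \<phi>
  proof -
    define a where "a n = dist_of_fun \<phi> (wave (- k n)) / of_real V" for n
    have "torus_smooth_tendsto (\<lambda>N x. \<Sum>n<N. a n * wave (k n) x) \<phi>"
      using fourier_inversion(3)[OF \<phi> k] unfolding a_def V_def .
    then have "(\<lambda>N. u (\<lambda>x. \<Sum>n<N. a n * wave (k n) x)) \<longlonglongrightarrow> u \<phi>"
      by (intro distribution_tendsto[OF u \<phi>] torus_smooth_sum wave_multiple_smooth kf) auto
    moreover have "u (\<lambda>x. \<Sum>n<N. a n * wave (k n) x) = (\<Sum>n<N. c n * dist_of_fun \<phi> (wave (- k n)))" for N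
    proof -
      have "u (\<lambda>x. \<Sum>n<N. a n * wave (k n) x) = (\<Sum>n<N. u (\<lambda>x. a n * wave (k n) x))"
        by (intro distribution_sum[OF u] wave_multiple_smooth kf) auto
      also have "\<dots> = (\<Sum>n<N. c n * dist_of_fun \<phi> (wave (- k n)))"
        by (simp only: distribution_cmult[OF u wave_smooth[OF kf]])
          (simp add: a_def c_def mult.commute)
      finally show ?thesis .
    qed
    ultimately have "(\<lambda>n. c n * dist_of_fun \<phi> (wave (- k n))) sums u \<phi>"
      by (simp add: sums_def)
    moreover have "(\<lambda>n. c n * dist_of_fun \<phi> (wave (- k n))) sums dist_of_fun f \<phi>"
      unfolding f_def by (rule dist_of_fun_wave_series[OF sc torus_smooth_continuous[OF \<phi>]])
    ultimately show ?thesis by (rule sums_unique2)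
  qed
  then show ?thesis using f by (auto simp: dist_is_smooth_def)
qed

lemma freqs_Pair_iff:
  "(\<tau>, real_of_int \<xi>) \<in> freqs \<longleftrightarrow> (\<forall>j. (\<tau> :: real ^ 'n::finite) $ j \<in> \<int>)"
proof -
  have "(\<tau>, real_of_int \<xi>) \<in> freqs \<longleftrightarrow> (\<forall>b\<in>Basis. \<tau> \<bullet> b \<in> \<int>)"
    by (auto simp: freqs_def Basis_prod_def)
  also have "\<dots> \<longleftrightarrow> (\<forall>j. \<tau> $ j \<in> \<int>)"
    by (auto simp: Basis_vec_def inner_axis)
  finally show ?thesis .
qed

lemma wave_Pair: "wave (\<tau>, \<xi>) (t, x) = wave \<tau> t * cis (\<xi> * x)"
  by (simp add: wave_def cis_mult)

lemma axis_in_Basis: "(axis j 1 :: real ^ 'n::finite, 0 :: real) \<in> Basis"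
  by (auto simp: Basis_prod_def Basis_vec_def)

lemma integral_cis_int:
  "integral {0..2 * pi} (\<lambda>x. cis (of_int m * x)) = (if m = 0 then of_real (2 * pi) else 0)"
proof -
  have "real_of_int m \<in> freqs" by (simp add: freqs_def)
  note I = integral_wave[OF this]
  have "wave (real_of_int m) = (\<lambda>x. cis (of_int m * x))" by (rule ext) (simp add: wave_def)
  moreover have C: "(cell :: real set) = {0..2 * pi}" by simp
  moreover have "measure lborel (cell :: real set) = 2 * pi" unfolding C by simp
  ultimately show ?thesis using I by (simp only: of_int_eq_0_iff)
qed

text \<open>The partial Fourier coefficient of a character vanishes for all frequencies but one, so the weak sum
defining the operator has a single nonzero term.\<close>
lemma op_of_symbol_wave:
  fixes u :: "((real ^ 'n::finite) \<times> real) functional"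
  assumes u: "torus_distribution u" and k: "(\<tau>, real_of_int \<xi>) \<in> freqs"
  shows "op_of_symbol p u (wave (- (\<tau>, of_int \<xi>))) = p \<xi> * u (wave (- (\<tau>, of_int \<xi>)))"
proof -
  let ?w = "wave (- (\<tau>, real_of_int \<xi>))"
  have w: "?w \<in> torus_smooth" by (rule wave_smooth[OF freqs_minus_iff[THEN iffD2, OF k]])
  have "integral {0..2 * pi} (\<lambda>x. ?w (t, x) * cis (of_int \<zeta> * x)) =
      (if \<zeta> = \<xi> then of_real (2 * pi) * wave (- \<tau>) t else 0)" for t \<zeta>
  proof -
    have "?w (t, x) * cis (of_int \<zeta> * x) = wave (- \<tau>) t * cis (of_int (\<zeta> - \<xi>) * x)" for x
      by (simp add: wave_Pair mult.assoc cis_mult algebra_simps)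
    then have "integral {0..2 * pi} (\<lambda>x. ?w (t, x) * cis (of_int \<zeta> * x)) =
        wave (- \<tau>) t * integral {0..2 * pi} (\<lambda>x. cis (of_int (\<zeta> - \<xi>) * x))"
      by simp
    then show ?thesis unfolding integral_cis_int by simp
  qed
  then have "fourier_coeff_x u \<zeta> (\<lambda>t. integral {0..2 * pi} (\<lambda>x. ?w (t, x) * cis (of_int \<zeta> * x))) =
      u (\<lambda>(t, x). (if \<zeta> = \<xi> then of_real (2 * pi) * wave (- \<tau>) t else 0) * cis (- (of_int \<zeta> * x)))
        / of_real (2 * pi)" for \<zeta>
    by (simp only: fourier_coeff_x_def)
  moreover have "u (\<lambda>(t, x). (if \<zeta> = \<xi> then of_real (2 * pi) * wave (- \<tau>) t else 0) * cis (- (of_int \<zeta> * x)))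
        / of_real (2 * pi) = (if \<zeta> = \<xi> then u ?w else 0)" for \<zeta>
  proof (cases "\<zeta> = \<xi>")
    case True
    have "(\<lambda>(t, x). of_real (2 * pi) * wave (- \<tau>) t * cis (- (of_int \<xi> * x))) =
        (\<lambda>z. of_real (2 * pi) * ?w z)"
      by (auto simp: wave_Pair)
    then show ?thesis using True distribution_cmult[OF u w, of "of_real (2 * pi)"] by simp
  next
    case False
    then show ?thesis using distribution_zero[OF u] by (simp add: case_prod_unfold)
  qed
  ultimately have "op_of_symbol p u ?w = (\<Sum>\<^sub>\<infinity>\<zeta>\<in>UNIV. p \<zeta> * (if \<zeta> = \<xi> then u ?w else 0))"
    by (simp only: op_of_symbol_def)
  also have "\<dots> = (\<Sum>\<^sub>\<infinity>\<zeta>\<in>{\<xi>}. p \<zeta> * (if \<zeta> = \<xi> then u ?w else 0))"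
    by (rule infsum_cong_neutral) auto
  also have "\<dots> = p \<xi> * u ?w" by simp
  finally show ?thesis .
qed

lemma D_t_wave:
  fixes u :: "((real ^ 'n::finite) \<times> real) functional"
  assumes u: "torus_distribution u" and k: "(\<tau>, real_of_int \<xi>) \<in> freqs"
  shows "D_t j u (wave (- (\<tau>, of_int \<xi>))) = of_real (\<tau> $ j) * u (wave (- (\<tau>, of_int \<xi>)))"
proof -
  let ?w = "wave (- (\<tau>, real_of_int \<xi>))"
  have "?w \<in> torus_smooth" by (rule wave_smooth[OF freqs_minus_iff[THEN iffD2, OF k]])
  moreover have "dir_deriv (axis j 1, 0) ?w = (\<lambda>x. (- \<i> * of_real (\<tau> $ j)) * ?w x)"
    by (rule ext, subst dir_deriv_eqI[OF wave_has_derivative]) (simp add: inner_axis)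
  ultimately have "u (dir_deriv (axis j 1, 0) ?w) = (- \<i> * of_real (\<tau> $ j)) * u ?w"
    using distribution_cmult[OF u] by metis
  then show ?thesis by (simp add: D_t_def mult.assoc)
qed

text \<open>The sign in \<open>wave (- k)\<close> reflects that the coefficient of \<open>u\<close> at \<open>k\<close> is obtained by testing
against the conjugate character.\<close>
lemma system_op_wave:
  fixes u :: "((real ^ 'n::finite) \<times> real) functional"
  assumes "torus_distribution u" and "(\<tau>, real_of_int \<xi>) \<in> freqs"
  shows "system_op p j u (wave (- (\<tau>, of_int \<xi>))) =
    (of_real (\<tau> $ j) + p j \<xi>) * u (wave (- (\<tau>, of_int \<xi>)))"
  by (simp add: system_op_def op_of_symbol_wave D_t_wave assms distrib_right del: uminus_Pair)

text \<open>A tail of the convergent series of \<open>summable_weight\<close> has terms below any positive bound.\<close>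
lemma finite_freqs_bounded: "finite {k \<in> freqs. weight (k :: 'a::euclidean_space) \<le> R}"
proof -
  obtain k :: "nat \<Rightarrow> 'a" where k: "inj k" "range k = freqs" using freqs_enumeration by blast
  define R' where "R' = max R 1"
  have "(\<lambda>n. 1 / weight (k n) ^ (2 * DIM('a))) \<longlonglongrightarrow> 0"
    using k summable_LIMSEQ_zero[OF summable_weight[of k]] by simp
  moreover have "0 < 1 / R' ^ (2 * DIM('a))" by (simp add: R'_def)
  ultimately have "\<forall>\<^sub>F n in sequentially. 1 / weight (k n) ^ (2 * DIM('a)) < 1 / R' ^ (2 * DIM('a))"
    by (rule order_tendstoD(2))
  then obtain n0 where n0: "\<And>n. n \<ge> n0 \<Longrightarrow> 1 / weight (k n) ^ (2 * DIM('a)) < 1 / R' ^ (2 * DIM('a))"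
    by (auto simp: eventually_sequentially)
  have "{l \<in> freqs :: 'a set. weight l \<le> R} \<subseteq> k ` {..<n0}"
  proof
    fix l :: 'a assume l: "l \<in> {l \<in> freqs. weight l \<le> R}"
    then obtain n where n: "l = k n" using k(2) by auto
    have "weight (k n) ^ (2 * DIM('a)) \<le> R' ^ (2 * DIM('a))"
      using l n by (intro power_mono) (auto simp: R'_def)
    then have "1 / R' ^ (2 * DIM('a)) \<le> 1 / weight (k n) ^ (2 * DIM('a))"
      by (intro divide_left_mono mult_pos_pos) (auto simp: R'_def)
    then have "\<not> n \<ge> n0" using n0[of n] by linarith
    then show "l \<in> k ` {..<n0}" using n by auto
  qed
  then show ?thesis using finite_subset by blast
qed

text \<open>Dividing the rapidly decaying coefficients of \<open>L\<^sub>j u\<close> by a symbol that is bounded below by a negative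
power of the weight loses only that power. The finitely many frequencies with weight at most \<open>R\<close> cannot
affect decay.\<close>
lemma globally_hypoelliptic_if_symbol_bounded_below:
  fixes p :: "'n::finite \<Rightarrow> int \<Rightarrow> complex"
  assumes c: "c > 0"
    and lower: "\<And>(\<tau> :: real ^ 'n) \<xi>. (\<forall>j. \<tau> $ j \<in> \<int>) \<Longrightarrow> weight (\<tau>, real_of_int \<xi>) > R \<Longrightarrow>
      \<exists>j. c \<le> norm (of_real (\<tau> $ j) + p j \<xi>) * weight (\<tau>, real_of_int \<xi>) ^ M"
  shows "globally_hypoelliptic (system_op p)"
  unfolding globally_hypoelliptic_def
proof (intro allI impI)
  fix u :: "((real ^ 'n) \<times> real) functional"
  assume u: "torus_distribution u" and smooth: "\<forall>j. dist_is_smooth (system_op p j u)"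
  have decay_L: "\<exists>C\<ge>0. \<forall>k\<in>freqs. norm (system_op p j u (wave k)) * weight k ^ N \<le> C" for j N
  proof -
    obtain f where "f \<in> torus_smooth" "\<And>\<phi>. \<phi> \<in> torus_smooth \<Longrightarrow> system_op p j u \<phi> = dist_of_fun f \<phi>"
      using smooth unfolding dist_is_smooth_def by blast
    then show ?thesis using wave_coefficients_decay[of f N] wave_smooth by metis
  qed
  show "dist_is_smooth u"
  proof (rule dist_is_smooth_if_decay[OF u])
    fix N
    obtain C where C: "\<And>j. C j \<ge> 0"
      "\<And>j k. k \<in> freqs \<Longrightarrow> norm (system_op p j u (wave k)) * weight k ^ (M + N) \<le> C j"
      using decay_L[of _ "M + N"] by metis
    define B where "B = (\<Sum>k\<in>{k \<in> freqs. weight k \<le> R}. norm (u (wave k)) * weight k ^ N)"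
    have B0: "B \<ge> 0" unfolding B_def by (intro sum_nonneg) auto
    \<comment> \<open>The index of the large symbol depends on the frequency, so the constants are summed over all indices.\<close>
    have SC: "C j \<le> sum C UNIV" "0 \<le> sum C UNIV" for j
      using C(1) by (auto intro: member_le_sum sum_nonneg)
    have "norm (u (wave k)) * weight k ^ N \<le> B + sum C UNIV / c" if k: "k \<in> freqs" for k
    proof (cases "weight k \<le> R")
      case True
      have "norm (u (wave k)) * weight k ^ N \<le> B"
        unfolding B_def using k True
        by (intro member_le_sum[of k _ "\<lambda>k. norm (u (wave k)) * weight k ^ N"] finite_freqs_bounded) auto
      moreover have "0 \<le> sum C UNIV / c" using SC c by simp
      ultimately show ?thesis by linarith
    next
      case False
      obtain \<tau> \<xi> where \<tau>: "- k = (\<tau>, real_of_int \<xi>)"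
      proof -
        have "snd k \<in> \<int>" using k by (cases k) (auto simp: freqs_def Basis_prod_def)
        then show ?thesis
          using that by (metis Ints_cases uminus_Pair of_int_minus prod.collapse)
      qed
      have k': "(\<tau>, real_of_int \<xi>) \<in> freqs" using k \<tau> by (metis freqs_minus_iff)
      have w: "weight (\<tau>, real_of_int \<xi>) = weight k" by (metis \<tau> weight_minus)
      have "\<forall>j. \<tau> $ j \<in> \<int>" by (rule freqs_Pair_iff[THEN iffD1, OF k'])
      then obtain j where j: "c \<le> norm (of_real (\<tau> $ j) + p j \<xi>) * weight k ^ M"
        using lower[of \<tau> \<xi>] False w by auto
      have "c * (norm (u (wave k)) * weight k ^ N) \<le>
          (norm (of_real (\<tau> $ j) + p j \<xi>) * weight k ^ M) * (norm (u (wave k)) * weight k ^ N)"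
        using j by (intro mult_right_mono) auto
      also have "\<dots> = norm (system_op p j u (wave k)) * weight k ^ (M + N)"
      proof -
        have "wave k = wave (- (\<tau>, real_of_int \<xi>))" by (simp only: \<tau>[symmetric] minus_minus)
        then have "system_op p j u (wave k) = (of_real (\<tau> $ j) + p j \<xi>) * u (wave k)"
          using system_op_wave[OF u k', of p j] by simp
        then show ?thesis by (simp add: norm_mult power_add)
      qed
      also have "\<dots> \<le> sum C UNIV" using C(2)[OF k, of j] SC(1)[of j] by linarith
      finally have "norm (u (wave k)) * weight k ^ N \<le> sum C UNIV / c"
        using c by (simp add: field_simps)
      then show ?thesis using B0 by linarith
    qed
    then show "\<exists>C. \<forall>k\<in>freqs. norm (u (wave k)) * weight k ^ N \<le> C" by blast
  qed
qed

section \<open>Resonant frequencies destroy hypoellipticity\<close>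

text \<open>The functional of the formal series \<open>\<Sum>l. wave (k l)\<close>, all of whose coefficients on the sequence
have the same size.\<close>
definition wave_sum_functional :: "(nat \<Rightarrow> 'a::euclidean_space) \<Rightarrow> 'a functional" where
  "wave_sum_functional k \<phi> = (\<Sum>l. dist_of_fun \<phi> (wave (k l)))"

lemma summable_coefficients:
  fixes k :: "nat \<Rightarrow> 'a::euclidean_space"
  assumes k: "inj k" "range k \<subseteq> freqs" and \<phi>: "\<phi> \<in> torus_smooth"
  shows "summable (\<lambda>l. norm (dist_of_fun \<phi> (wave (k l))) * weight (k l) ^ N)"
proof -
  have "rapidly_decaying k (\<lambda>l. dist_of_fun \<phi> (wave (k l)))"
    unfolding rapidly_decaying_def using wave_coefficients_decay[OF \<phi>] k(2) by (metis rangeI subsetD)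
  then show ?thesis by (rule rapidly_decaying_summable[OF k])
qed

lemma summable_coefficient_sequence:
  assumes "inj k" "range k \<subseteq> freqs" "\<phi> \<in> torus_smooth"
  shows "summable (\<lambda>l. dist_of_fun \<phi> (wave (k l)))"
  using summable_coefficients[OF assms, of 0] by (simp add: summable_norm_cancel)

lemma dist_of_fun_add_wave:
  "f \<in> torus_smooth \<Longrightarrow> g \<in> torus_smooth \<Longrightarrow>
    dist_of_fun (\<lambda>x. f x + g x) (wave k) = dist_of_fun f (wave k) + dist_of_fun g (wave k)"
  unfolding dist_of_fun_wave distrib_right
  by (rule integral_add) (auto intro: torus_smooth_wave_integrable)

lemma dist_of_fun_cmult_wave: "dist_of_fun (\<lambda>x. c * f x) (wave k) = c * dist_of_fun f (wave k)"
  by (simp add: dist_of_fun_wave mult.assoc)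

lemma wave_sum_functional_add:
  assumes "inj k" "range k \<subseteq> freqs" "f \<in> torus_smooth" "g \<in> torus_smooth"
  shows "wave_sum_functional k (\<lambda>x. f x + g x) = wave_sum_functional k f + wave_sum_functional k g"
  unfolding wave_sum_functional_def dist_of_fun_add_wave[OF assms(3,4)]
  by (rule suminf_add[symmetric]; rule summable_coefficient_sequence; fact)

lemma wave_sum_functional_cmult:
  assumes "inj k" "range k \<subseteq> freqs" "f \<in> torus_smooth"
  shows "wave_sum_functional k (\<lambda>x. c * f x) = c * wave_sum_functional k f"
  unfolding wave_sum_functional_def dist_of_fun_cmult_wave
  by (rule suminf_mult, rule summable_coefficient_sequence) fact+

text \<open>Convergence and continuity both come from \<open>wave_coefficient_bound\<close> with the exponent for which
\<open>summable_weight\<close> gives a convergent series.\<close>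
lemma wave_sum_functional_distribution:
  fixes k :: "nat \<Rightarrow> 'a::euclidean_space"
  assumes k: "inj k" "range k \<subseteq> freqs"
  shows "torus_distribution (wave_sum_functional k)"
  unfolding torus_distribution_def
proof (intro conjI ballI allI impI)
  fix \<Phi> :: "nat \<Rightarrow> 'a \<Rightarrow> complex" and \<phi> :: "'a \<Rightarrow> complex"
  assume \<phi>: "\<phi> \<in> torus_smooth" and \<Phi>: "\<forall>m. \<Phi> m \<in> torus_smooth" and lim: "torus_smooth_tendsto \<Phi> \<phi>"
  let ?D = "2 * DIM('a)"
  define A where "A = (1 + real DIM('a)) ^ ?D * measure lborel (cell :: 'a set)"
  define S where "S = (\<Sum>l. 1 / weight (k l) ^ ?D)"
  have A0: "A \<ge> 0" by (simp add: A_def)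
  have S0: "S \<ge> 0" unfolding S_def by (intro suminf_nonneg summable_weight k) auto
  have uni: "\<forall>\<^sub>F m in sequentially. \<forall>x. dist (iter_partial bs (\<Phi> m) x) (iter_partial bs \<phi> x) < e"
    if "set bs \<subseteq> Basis" "e > 0" for bs e
    using lim that unfolding torus_smooth_tendsto_def uniform_limit_iff by simp
  show "(\<lambda>m. wave_sum_functional k (\<Phi> m)) \<longlonglongrightarrow> wave_sum_functional k \<phi>"
  proof (rule tendstoI)
    fix e :: real assume e: "e > 0"
    \<comment> \<open>The summand 1 keeps the denominator positive also when \<open>A * S\<close> vanishes.\<close>
    define d where "d = e / (A * S + 1)"
    have AS: "A * S + 1 > 0" using A0 S0 by (simp add: add_nonneg_pos)
    then have d: "d > 0" using e by (simp add: d_def)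
    have "\<forall>\<^sub>F m in sequentially. \<forall>b\<in>Basis. \<forall>x.
        dist (iter_partial (replicate ?D b) (\<Phi> m) x) (iter_partial (replicate ?D b) \<phi> x) < d"
      by (rule eventually_ball_finite) (auto intro!: uni d)
    moreover have "\<forall>\<^sub>F m in sequentially. \<forall>x. dist (\<Phi> m x) (\<phi> x) < d"
      using uni[of "[]" d] d by simp
    ultimately show "\<forall>\<^sub>F m in sequentially. dist (wave_sum_functional k (\<Phi> m)) (wave_sum_functional k \<phi>) < e"
    proof eventually_elim
      case (elim m)
      define h where "h = (\<lambda>x. \<Phi> m x + (- 1) * \<phi> x)"
      have m\<phi>: "(\<lambda>x. (- 1) * \<phi> x) \<in> torus_smooth" by (rule torus_smooth_cmult[OF \<phi>])
      have h: "h \<in> torus_smooth" unfolding h_def using \<Phi> m\<phi> by (intro torus_smooth_add) auto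
      have hb: "norm (dist_of_fun h (wave (k l))) * weight (k l) ^ ?D \<le> A * d" for l
        unfolding A_def
      proof (rule wave_coefficient_bound[OF h])
        show "k l \<in> freqs" using k(2) by blast
        show "norm (h x) \<le> d" for x
          using elim(2) by (simp add: h_def dist_norm less_imp_le)
        show "norm (iter_partial (replicate ?D b) h x) \<le> d" if b: "b \<in> Basis" for x b
        proof -
          have bs: "set (replicate ?D b) \<subseteq> Basis" using b by auto
          have "iter_partial (replicate ?D b) h x =
              iter_partial (replicate ?D b) (\<Phi> m) x - iter_partial (replicate ?D b) \<phi> x"
            unfolding h_def using iter_partial_add[OF _ m\<phi> bs, of "\<Phi> m"] iter_partial_cmult[OF \<phi> bs, of "- 1"] \<Phi>
            by simp
          then show ?thesis using elim(1) b by (metis dist_norm less_imp_le)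
        qed
      qed
      have hw: "norm (dist_of_fun h (wave (k l))) \<le> (A * d) * (1 / weight (k l) ^ ?D)" for l
        using hb[of l] by (simp add: field_simps)
      have sh: "summable (\<lambda>l. norm (dist_of_fun h (wave (k l))))"
        using summable_coefficients[OF k h, of 0] by simp
      have "wave_sum_functional k h = wave_sum_functional k (\<Phi> m) + (- 1) * wave_sum_functional k \<phi>"
        unfolding h_def using wave_sum_functional_add[OF k _ m\<phi>, of "\<Phi> m"] \<Phi>
          wave_sum_functional_cmult[OF k \<phi>, of "- 1"] by metis
      then have "dist (wave_sum_functional k (\<Phi> m)) (wave_sum_functional k \<phi>) = norm (wave_sum_functional k h)"
        by (simp add: dist_norm)
      also have "\<dots> \<le> (\<Sum>l. norm (dist_of_fun h (wave (k l))))"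
        unfolding wave_sum_functional_def by (rule summable_norm[OF sh])
      also have "\<dots> \<le> (\<Sum>l. (A * d) * (1 / weight (k l) ^ ?D))"
        by (intro suminf_le hw sh summable_mult summable_weight k)
      also have "\<dots> = (A * d) * S"
        unfolding S_def by (intro suminf_mult summable_weight k)
      also have "\<dots> = (A * S) * d" by simp
      also have "\<dots> < (A * S + 1) * d" using d by simp
      also have "\<dots> = e" using AS by (simp add: d_def)
      finally show ?case .
    qed
  qed
qed (auto simp only: wave_sum_functional_add[OF k] wave_sum_functional_cmult[OF k])

text \<open>The coefficients at the frequencies \<open>- k n\<close> are constant and nonzero, whereas those of a smooth
function tend to zero.\<close>
lemma wave_sum_functional_not_smooth:
  fixes k :: "nat \<Rightarrow> 'a::euclidean_space"
  assumes k: "inj k" "range k \<subseteq> freqs"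
  shows "\<not> dist_is_smooth (wave_sum_functional k)"
proof
  assume "dist_is_smooth (wave_sum_functional k)"
  then obtain f where f: "f \<in> torus_smooth"
    "\<And>\<phi>. \<phi> \<in> torus_smooth \<Longrightarrow> wave_sum_functional k \<phi> = dist_of_fun f \<phi>"
    unfolding dist_is_smooth_def by blast
  define V where "V = measure lborel (cell :: 'a set)"
  have V: "V > 0" unfolding V_def by (rule volume_cell_pos)
  have kf: "k n \<in> freqs" for n using k(2) by blast
  have "wave_sum_functional k (wave (- k n)) = of_real V" for n
  proof -
    have "dist_of_fun (wave (- k n)) (wave (k l)) = (if l = n then of_real V else 0)" for l
    proof -
      have "dist_of_fun (wave (- k n)) (wave (k l)) = integral cell (wave (- k n + k l))"
        by (simp only: dist_of_fun_wave wave_add[abs_def])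
      also have "\<dots> = (if - k n + k l = 0 then of_real V else 0)"
        using integral_wave[OF freqs_add[of "- k n" "k l"]] kf by (simp only: V_def freqs_minus_iff)
      also have "- k n + k l = 0 \<longleftrightarrow> l = n"
        using k(1) by (auto simp: inj_eq)
      finally show ?thesis .
    qed
    then show ?thesis
      unfolding wave_sum_functional_def
      using sums_unique[OF sums_single[of n "\<lambda>_. complex_of_real V"]] by simp
  qed
  then have "dist_of_fun f (wave (- k n)) = of_real V" for n
    using f(2)[OF wave_smooth[OF freqs_minus_iff[THEN iffD2, OF kf]]] by simp
  moreover have "(\<lambda>n. dist_of_fun f (wave (- k n))) \<longlonglongrightarrow> 0"
  proof (rule summable_LIMSEQ_zero, rule summable_norm_cancel)
    have "inj (\<lambda>n. - k n)" "range (\<lambda>n. - k n) \<subseteq> freqs"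
      using k(1) kf by (auto simp: inj_on_def)
    from summable_coefficients[OF this f(1), of 0]
    show "summable (\<lambda>n. norm (dist_of_fun f (wave (- k n))))" by simp
  qed
  ultimately have "of_real V = (0::complex)" by (simp add: LIMSEQ_const_iff)
  then show False using V by simp
qed

lemma cell_Pair: "(cell :: ((real ^ 'n::finite) \<times> real) set) = cbox (0, 0) ((2 * pi) *\<^sub>R One, 2 * pi)"
proof -
  have "(2 * pi) *\<^sub>R One = ((2 * pi) *\<^sub>R One :: real ^ 'n, 2 * pi)"
  proof (rule euclidean_eqI)
    fix b :: "(real ^ 'n) \<times> real" assume b: "b \<in> Basis"
    then have "((2 * pi) *\<^sub>R One :: real ^ 'n, 2 * pi) \<bullet> b = 2 * pi"
      by (auto simp: Basis_prod_def)
    then show "(2 * pi) *\<^sub>R One \<bullet> b = ((2 * pi) *\<^sub>R One :: real ^ 'n, 2 * pi) \<bullet> b"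
      using b by simp
  qed
  then show ?thesis by (simp add: zero_prod_def)
qed

text \<open>The component of \<open>\<phi>\<close> of frequency \<open>- \<zeta>\<close> in \<open>x\<close>, paired with a character: by Fubini the integral over
\<open>x\<close> splits off and vanishes unless the frequencies match.\<close>
lemma dist_of_fun_projection:
  fixes \<phi> :: "(real ^ 'n::finite) \<times> real \<Rightarrow> complex"
  assumes \<phi>: "continuous_on UNIV \<phi>"
  shows "dist_of_fun (\<lambda>(t, x). integral {0..2 * pi} (\<lambda>y. \<phi> (t, y) * cis (of_int \<zeta> * y)) * cis (- (of_int \<zeta> * x)))
      (wave (\<tau>, of_int \<xi>)) =
    (if \<xi> = \<zeta> then of_real (2 * pi) * dist_of_fun \<phi> (wave (\<tau>, of_int \<xi>)) else 0)"
proof -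
  let ?C = "cbox 0 ((2 * pi) *\<^sub>R One) :: (real ^ 'n) set"
  define \<psi> where "\<psi> t = integral (cbox 0 (2 * pi)) (\<lambda>y. \<phi> (t, y) * cis (of_int \<zeta> * y))" for t
  have c\<psi>: "continuous_on UNIV \<psi>"
    unfolding \<psi>_def
    by (rule integral_continuous_on_param)
      (auto simp: split_beta intro!: continuous_on_mult continuous_on_compose2[OF \<phi>] continuous_intros)
  have fubini: "integral cell g = integral ?C (\<lambda>t. integral {0..2 * pi} (\<lambda>x. g (t, x)))"
    if "continuous_on UNIV g" for g :: "(real ^ 'n) \<times> real \<Rightarrow> complex"
    unfolding cell_Pair
    using integral_prod_continuous[OF continuous_on_subset[OF that subset_UNIV], of 0 0 "(2 * pi) *\<^sub>R One" "2 * pi"]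
    by simp
  have "dist_of_fun (\<lambda>(t, x). \<psi> t * cis (- (of_int \<zeta> * x))) (wave (\<tau>, of_int \<xi>)) =
      integral cell (\<lambda>z. \<psi> (fst z) * cis (- (of_int \<zeta> * snd z)) * wave (\<tau>, of_int \<xi>) z)"
    by (simp add: dist_of_fun_wave split_beta)
  also have "\<dots> = integral ?C (\<lambda>t. integral {0..2 * pi} (\<lambda>x. \<psi> t * wave \<tau> t * cis (of_int (\<xi> - \<zeta>) * x)))"
  proof (subst fubini)
    show "continuous_on UNIV (\<lambda>z. \<psi> (fst z) * cis (- (of_int \<zeta> * snd z)) * wave (\<tau>, real_of_int \<xi>) z)"
      by (intro continuous_on_mult continuous_on_compose2[OF c\<psi>] continuous_on_wave continuous_intros) auto
    have "\<psi> t * cis (- (of_int \<zeta> * x)) * wave (\<tau>, real_of_int \<xi>) (t, x) =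
        \<psi> t * wave \<tau> t * cis (of_int (\<xi> - \<zeta>) * x)" for t x
    proof -
      have "cis (- (of_int \<zeta> * x)) * cis (of_int \<xi> * x) = cis (of_int (\<xi> - \<zeta>) * x)"
        by (simp add: cis_mult algebra_simps)
      then show ?thesis by (simp add: wave_Pair mult_ac)
    qed
    then show "integral ?C (\<lambda>t. integral {0..2 * pi}
         (\<lambda>x. \<psi> (fst (t, x)) * cis (- (of_int \<zeta> * snd (t, x))) * wave (\<tau>, real_of_int \<xi>) (t, x))) =
       integral ?C (\<lambda>t. integral {0..2 * pi} (\<lambda>x. \<psi> t * wave \<tau> t * cis (of_int (\<xi> - \<zeta>) * x)))"
      by (simp only: fst_conv snd_conv)
  qed
  also have "\<dots> = integral ?C (\<lambda>t. \<psi> t * wave \<tau> t * (if \<xi> - \<zeta> = 0 then of_real (2 * pi) else 0))"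
    by (simp only: integral_mult_right integral_cis_int)
  also have "\<dots> = (if \<xi> = \<zeta> then of_real (2 * pi) * dist_of_fun \<phi> (wave (\<tau>, of_int \<xi>)) else 0)"
  proof (cases "\<xi> = \<zeta>")
    case True
    have "dist_of_fun \<phi> (wave (\<tau>, of_int \<xi>)) =
        integral ?C (\<lambda>t. integral {0..2 * pi} (\<lambda>x. \<phi> (t, x) * wave (\<tau>, of_int \<xi>) (t, x)))"
      unfolding dist_of_fun_wave by (rule fubini) (intro continuous_on_mult \<phi> continuous_on_wave)
    also have "\<dots> = integral ?C (\<lambda>t. integral {0..2 * pi} (\<lambda>x. wave \<tau> t * (\<phi> (t, x) * cis (of_int \<zeta> * x))))"
      by (simp add: wave_Pair True mult_ac)
    also have "\<dots> = integral ?C (\<lambda>t. \<psi> t * wave \<tau> t)"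
      by (simp only: integral_mult_right \<psi>_def box_real mult.commute)
    finally have "dist_of_fun \<phi> (wave (\<tau>, of_int \<xi>)) = integral ?C (\<lambda>t. \<psi> t * wave \<tau> t)" .
    then show ?thesis
      using True by (simp only: diff_self simp_thms if_True integral_mult_left mult.commute)
  next
    case False
    then show ?thesis by simp
  qed
  finally show ?thesis unfolding \<psi>_def by (simp only: box_real)
qed

text \<open>Injectivity of \<open>\<xi>\<close> makes each partial Fourier coefficient of the sum a single term, so
the unordered sum over \<open>\<zeta>\<close> becomes a series over the sequence.\<close>
lemma op_of_symbol_wave_sum:
  fixes \<tau> :: "nat \<Rightarrow> real ^ 'n::finite" and \<xi> :: "nat \<Rightarrow> int"
  defines "k \<equiv> \<lambda>l. (\<tau> l, real_of_int (\<xi> l))"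
  assumes \<xi>: "inj \<xi>" and \<phi>: "continuous_on UNIV \<phi>"
    and summ: "summable (\<lambda>l. norm (p (\<xi> l) * dist_of_fun \<phi> (wave (k l))))"
  shows "op_of_symbol p (wave_sum_functional k) \<phi> = (\<Sum>l. p (\<xi> l) * dist_of_fun \<phi> (wave (k l)))"
proof -
  let ?F = "\<lambda>\<zeta>. fourier_coeff_x (wave_sum_functional k) \<zeta>
      (\<lambda>t. integral {0..2 * pi} (\<lambda>x. \<phi> (t, x) * cis (of_int \<zeta> * x)))"
  have F: "?F \<zeta> = (\<Sum>l. if \<xi> l = \<zeta> then dist_of_fun \<phi> (wave (k l)) else 0)" for \<zeta>
  proof -
    have "?F \<zeta> = (\<Sum>l. if \<xi> l = \<zeta> then of_real (2 * pi) * dist_of_fun \<phi> (wave (k l)) else 0) / of_real (2 * pi)"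
      unfolding fourier_coeff_x_def wave_sum_functional_def
      by (simp only: k_def dist_of_fun_projection[OF \<phi>])
    also have "\<dots> = (\<Sum>l. if \<xi> l = \<zeta> then dist_of_fun \<phi> (wave (k l)) else 0)"
    proof -
      have "finite {l. \<xi> l = \<zeta>}"
        using \<xi> finite_vimageI[of "{\<zeta>}" \<xi>] by (simp add: vimage_def)
      then show ?thesis
        by (subst (1 2) suminf_finite[of "{l. \<xi> l = \<zeta>}"]) (auto simp: sum_divide_distrib)
    qed
    finally show ?thesis .
  qed
  have F_range: "?F (\<xi> l) = dist_of_fun \<phi> (wave (k l))" for l
  proof -
    have "?F (\<xi> l) = (\<Sum>m. if m = l then dist_of_fun \<phi> (wave (k m)) else 0)"
      unfolding F using \<xi> by (simp add: inj_eq)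
    then show ?thesis using sums_unique[OF sums_single[of l "\<lambda>m. dist_of_fun \<phi> (wave (k m))"]] by simp
  qed
  have F_off: "?F \<zeta> = 0" if "\<zeta> \<notin> range \<xi>" for \<zeta>
  proof -
    have "\<xi> l \<noteq> \<zeta>" for l using that by auto
    then show ?thesis unfolding F by simp
  qed
  have "op_of_symbol p (wave_sum_functional k) \<phi> = (\<Sum>\<^sub>\<infinity>\<zeta>\<in>UNIV. p \<zeta> * ?F \<zeta>)"
    by (simp only: op_of_symbol_def)
  also have "\<dots> = (\<Sum>\<^sub>\<infinity>\<zeta>\<in>range \<xi>. p \<zeta> * ?F \<zeta>)"
  proof (rule infsum_cong_neutral)
    fix \<zeta> assume "\<zeta> \<in> UNIV - range \<xi>"
    then have "\<zeta> \<notin> range \<xi>" by blast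
    from F_off[OF this] show "p \<zeta> * ?F \<zeta> = 0" by (simp only: mult_zero_right)
  qed auto
  also have "\<dots> = (\<Sum>\<^sub>\<infinity>l\<in>UNIV. p (\<xi> l) * ?F (\<xi> l))"
    using infsum_reindex[OF \<xi>, of "\<lambda>\<zeta>. p \<zeta> * ?F \<zeta>"] by (simp only: o_def)
  also have "\<dots> = (\<Sum>\<^sub>\<infinity>l\<in>UNIV. p (\<xi> l) * dist_of_fun \<phi> (wave (k l)))"
    by (simp only: F_range)
  also have "\<dots> = (\<Sum>l. p (\<xi> l) * dist_of_fun \<phi> (wave (k l)))"
    using norm_summable_imp_has_sum[OF summ summable_sums[OF summable_norm_cancel[OF summ]]]
    by (rule infsumI)
  finally show ?thesis .
qed

text \<open>For the sum \<open>u\<close> of the characters, \<open>L\<^sub>j u\<close> is the series of the same characters with the rapidly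
decaying symbol values as coefficients, hence smooth, while \<open>u\<close> is not.\<close>
lemma not_globally_hypoelliptic_if_symbol_decays:
  fixes p :: "'n::finite \<Rightarrow> int \<Rightarrow> complex" and \<tau> :: "nat \<Rightarrow> real ^ 'n" and \<xi> :: "nat \<Rightarrow> int"
  assumes \<xi>: "inj \<xi>" and \<tau>: "\<And>l j. \<tau> l $ j \<in> \<int>"
    and decay: "\<And>j. rapidly_decaying (\<lambda>l. (\<tau> l, real_of_int (\<xi> l))) (\<lambda>l. of_real (\<tau> l $ j) + p j (\<xi> l))"
  shows "\<not> globally_hypoelliptic (system_op p)"
proof
  assume gh: "globally_hypoelliptic (system_op p)"
  define k where "k = (\<lambda>l. (\<tau> l, real_of_int (\<xi> l)))"
  have k: "inj k" "range k \<subseteq> freqs"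
    using \<xi> \<tau> by (auto simp: k_def inj_on_def freqs_Pair_iff)
  have kf: "k l \<in> freqs" for l using k(2) by blast
  let ?u = "wave_sum_functional k"
  have "dist_is_smooth (system_op p j ?u)" for j
  proof -
    define c where "c l = complex_of_real (\<tau> l $ j) + p j (\<xi> l)" for l
    have rd: "rapidly_decaying k c" using decay[of j] by (simp add: k_def c_def[abs_def])
    define f where "f = (\<lambda>x. \<Sum>l. c l * wave (k l) x)"
    have f: "f \<in> torus_smooth" unfolding f_def by (rule wave_series_smooth[OF k rd])
    have "system_op p j ?u \<phi> = dist_of_fun f \<phi>" if \<phi>: "\<phi> \<in> torus_smooth" for \<phi>
    proof -
      define a where "a l = dist_of_fun \<phi> (wave (k l))" for l
      have sa: "summable (\<lambda>l. norm (a l) * weight (k l) ^ N)" for N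
        unfolding a_def by (rule summable_coefficients[OF k \<phi>])
      have \<tau>w: "\<bar>\<tau> l $ j\<bar> \<le> weight (k l)" for l
        using component_le_norm_cart[of "\<tau> l" j] norm_fst_le[of "\<tau> l" "real_of_int (\<xi> l)"]
        by (simp add: weight_def k_def)
      have s\<tau>: "summable (\<lambda>l. norm (of_real (\<tau> l $ j) * a l))"
      proof (rule summable_comparison_test'[OF sa[of 1], of 0])
        show "norm (norm (of_real (\<tau> l $ j) * a l)) \<le> norm (a l) * weight (k l) ^ 1" for l
          using mult_left_mono[OF \<tau>w norm_ge_zero, of "a l" l] by (simp add: norm_mult mult.commute)
      qed
      obtain C where C: "\<And>l. norm (c l) \<le> C"
        using rd[unfolded rapidly_decaying_def, rule_format, of 0] by auto
      have sc: "summable (\<lambda>l. norm (c l * a l))"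
        by (rule summable_comparison_test'[OF summable_mult[OF sa[of 0], of C], of 0])
          (simp add: norm_mult mult_right_mono C)
      have sp: "summable (\<lambda>l. norm (p j (\<xi> l) * a l))"
      proof (rule summable_comparison_test'[OF summable_add[OF sc s\<tau>], of 0])
        fix l
        have "p j (\<xi> l) * a l = c l * a l - of_real (\<tau> l $ j) * a l"
          by (simp add: c_def algebra_simps)
        then show "norm (norm (p j (\<xi> l) * a l)) \<le> norm (c l * a l) + norm (of_real (\<tau> l $ j) * a l)"
          by (metis norm_triangle_ineq4 real_norm_def abs_norm_cancel)
      qed
      have "D_t j ?u \<phi> = inverse \<i> * (- (\<Sum>l. - \<i> * (of_real (\<tau> l $ j) * a l)))"
      proof -
        have "dist_of_fun (dir_deriv (axis j 1, 0) \<phi>) (wave (k l)) = - \<i> * (of_real (\<tau> l $ j) * a l)" for l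
          using dist_of_fun_dir_deriv[OF \<phi> kf axis_in_Basis, of j l]
          by (simp add: k_def a_def inner_axis)
        then show ?thesis by (simp add: D_t_def wave_sum_functional_def)
      qed
      also have "(\<Sum>l. - \<i> * (of_real (\<tau> l $ j) * a l)) = - \<i> * (\<Sum>l. of_real (\<tau> l $ j) * a l)"
        by (rule suminf_mult[OF summable_norm_cancel[OF s\<tau>]])
      also have "inverse \<i> * (- (- \<i> * (\<Sum>l. of_real (\<tau> l $ j) * a l))) = (\<Sum>l. of_real (\<tau> l $ j) * a l)"
        by simp
      finally have Dt: "D_t j ?u \<phi> = (\<Sum>l. of_real (\<tau> l $ j) * a l)" .
      have "op_of_symbol (p j) ?u \<phi> = (\<Sum>l. p j (\<xi> l) * a l)"
        using op_of_symbol_wave_sum[OF \<xi> torus_smooth_continuous[OF \<phi>], of "p j" \<tau>] sp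
        by (simp add: k_def a_def)
      then have "system_op p j ?u \<phi> = (\<Sum>l. of_real (\<tau> l $ j) * a l) + (\<Sum>l. p j (\<xi> l) * a l)"
        by (simp add: system_op_def Dt)
      also have "\<dots> = (\<Sum>l. c l * a l)"
        unfolding c_def distrib_right
        by (rule suminf_add[OF summable_norm_cancel[OF s\<tau>] summable_norm_cancel[OF sp]])
      also have "\<dots> = dist_of_fun f \<phi>"
        unfolding f_def a_def
        using dist_of_fun_wave_series[OF _ torus_smooth_continuous[OF \<phi>], of c k]
          rapidly_decaying_summable[OF k rd, of 0]
        by (simp add: sums_iff)
      finally show ?thesis .
    qed
    then show ?thesis using f by (auto simp: dist_is_smooth_def)
  qed
  then have "dist_is_smooth ?u"
    using gh wave_sum_functional_distribution[OF k] unfolding globally_hypoelliptic_def by blast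
  then show False using wave_sum_functional_not_smooth[OF k] by blast
qed

section \<open>Approximation by powers and roots\<close>

lemma power_add_superadditive:
  fixes x y :: real
  assumes "0 \<le> x" "0 \<le> y" "n > 0"
  shows "x ^ n + y ^ n \<le> (x + y) ^ n"
  using assms(3)
proof (induction n rule: nat_induct_non_zero)
  case (Suc n)
  have "x ^ Suc n + y ^ Suc n \<le> (x + y) * (x ^ n + y ^ n)"
    using assms(1,2) by (simp add: algebra_simps)
  also have "\<dots> \<le> (x + y) * (x + y) ^ n"
    using assms(1,2) Suc by (intro mult_left_mono) auto
  finally show ?case by simp
qed simp

text \<open>This inequality carries closeness of \<open>\<eta>\<close>-th powers back to closeness of the numbers themselves
at the price of an \<open>\<eta>\<close>-th root.\<close>
lemma abs_diff_power_le:
  fixes x y :: real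
  assumes "0 \<le> x" "0 \<le> y" "n > 0"
  shows "\<bar>x - y\<bar> ^ n \<le> \<bar>x ^ n - y ^ n\<bar>"
proof -
  have *: "\<bar>u - v\<bar> ^ n \<le> \<bar>u ^ n - v ^ n\<bar>" if "0 \<le> v" "v \<le> u" for u v :: real
    using power_add_superadditive[of "u - v" v n] that assms(3) by simp
  show ?thesis
  proof (cases "y \<le> x")
    case True
    then show ?thesis using *[OF assms(2)] by simp
  next
    case False
    then show ?thesis using *[of x y] assms(1) by (simp add: abs_minus_commute)
  qed
qed

lemma power_diff_le:
  fixes x y B :: real
  assumes "\<bar>x\<bar> \<le> B" "\<bar>y\<bar> \<le> B" "1 \<le> B"
  shows "\<bar>x ^ n - y ^ n\<bar> \<le> real n * B ^ n * \<bar>x - y\<bar>"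
proof (induction n)
  case (Suc n)
  have "x ^ Suc n - y ^ Suc n = x * (x ^ n - y ^ n) + (x - y) * y ^ n"
    by (simp add: algebra_simps)
  then have "\<bar>x ^ Suc n - y ^ Suc n\<bar> \<le> \<bar>x\<bar> * \<bar>x ^ n - y ^ n\<bar> + \<bar>x - y\<bar> * \<bar>y\<bar> ^ n"
    by (metis abs_mult abs_triangle_ineq power_abs)
  also have "\<dots> \<le> B * (real n * B ^ n * \<bar>x - y\<bar>) + \<bar>x - y\<bar> * B ^ Suc n"
  proof (intro add_mono mult_mono Suc assms)
    have "\<bar>y\<bar> ^ n \<le> B ^ n" using assms by (intro power_mono) auto
    also have "\<dots> \<le> B ^ Suc n" using assms(3) by (intro power_increasing) auto
    finally show "\<bar>y\<bar> ^ n \<le> B ^ Suc n" .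
  qed (use assms in auto)
  also have "\<dots> = real (Suc n) * B ^ Suc n * \<bar>x - y\<bar>"
    by (simp add: algebra_simps)
  finally show ?case .
qed simp

text \<open>The approximation property in \<open>SDA\<close>, separated from irrationality and with the maximum over the
coordinates expanded.\<close>
definition approximable :: "nat \<Rightarrow> real ^ 'n::finite \<Rightarrow> bool" where
  "approximable \<eta> \<alpha> \<longleftrightarrow> (\<exists>C>0. \<exists>(p :: nat \<Rightarrow> int ^ 'n) (q :: nat \<Rightarrow> nat).
     (\<forall>l\<ge>1. q l > 0) \<and> filterlim q at_top sequentially \<and>
     (\<forall>l\<ge>1. \<forall>j. \<bar>(\<alpha> $ j) ^ \<eta> - real_of_int (p l $ j) ^ \<eta> / real (q l)\<bar> < C / real (q l) ^ l))"

lemma SDA_iff: "SDA \<eta> \<alpha> \<longleftrightarrow> \<not> rational_vec \<alpha> \<and> approximable \<eta> \<alpha>"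
proof -
  have "(MAX j. f j) < C * real q powi (- int l) \<longleftrightarrow> (\<forall>j. f j < C / real q ^ l)"
    for f :: "'a \<Rightarrow> real" and C q l
    by (subst Max_less_iff) (auto simp: power_int_minus divide_inverse)
  then show ?thesis by (simp only: SDA_def approximable_def)
qed

lemma common_denominator:
  assumes "rational_vec (\<alpha> :: real ^ 'n::finite)"
  obtains D :: nat where "D > 0" "\<And>j. real D * \<alpha> $ j \<in> \<int>"
proof -
  have "\<exists>d::nat. d > 0 \<and> real d * \<alpha> $ j \<in> \<int>" for j
  proof -
    obtain a b :: int where "b > 0" "\<alpha> $ j = of_int a / of_int b"
      using assms unfolding rational_vec_def by (metis Rats_cases')
    then have "real (nat b) * \<alpha> $ j = of_int a" "nat b > 0" by simp_all
    then show ?thesis by (metis Ints_of_int)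
  qed
  then obtain d :: "'n \<Rightarrow> nat" where d: "\<And>j. d j > 0" "\<And>j. real (d j) * \<alpha> $ j \<in> \<int>" by metis
  show thesis
  proof
    show "(\<Prod>j\<in>UNIV. d j) > 0" using d by (simp add: prod_pos)
    fix j
    have "(\<Prod>j\<in>UNIV. d j) = (\<Prod>i\<in>UNIV - {j}. d i) * d j"
      by (subst prod.remove[of UNIV j]) auto
    then have "real (\<Prod>j\<in>UNIV. d j) * \<alpha> $ j = of_nat (\<Prod>i\<in>UNIV - {j}. d i) * (real (d j) * \<alpha> $ j)"
      by (simp only: of_nat_mult mult.assoc)
    then show "real (\<Prod>j\<in>UNIV. d j) * \<alpha> $ j \<in> \<int>"
      using Ints_mult[OF Ints_of_nat d(2)] by metis
  qed
qed

text \<open>With a common denominator \<open>D\<close>, the number \<open>\<alpha>\<^sub>j\<^sup>\<eta>\<close> equals \<open>(D (l + 1) \<alpha>\<^sub>j)\<^sup>\<eta> / (D (l + 1))\<^sup>\<eta>\<close>, so the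
approximation is exact with denominators \<open>(D (l + 1))\<^sup>\<eta>\<close>.\<close>
lemma rational_imp_approximable:
  assumes \<alpha>: "rational_vec (\<alpha> :: real ^ 'n::finite)" and \<eta>: "\<eta> > 0"
  shows "approximable \<eta> \<alpha>"
proof -
  obtain D :: nat where D: "D > 0" "\<And>j. real D * \<alpha> $ j \<in> \<int>"
    using common_denominator[OF \<alpha>] by blast
  define q where "q l = (D * Suc l) ^ \<eta>" for l
  define p :: "nat \<Rightarrow> int ^ 'n" where "p l = (\<chi> j. \<lfloor>real D * \<alpha> $ j\<rfloor> * int (Suc l))" for l
  have q: "l \<le> q l" "q l > 0" for l
  proof -
    have "l \<le> D * Suc l" using D(1) by (cases D) auto
    also have "\<dots> \<le> q l" unfolding q_def using D(1) \<eta> by (intro self_le_power) auto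
    finally show "l \<le> q l" .
    show "q l > 0" using D(1) by (simp add: q_def)
  qed
  have "real_of_int (p l $ j) ^ \<eta> / real (q l) = (\<alpha> $ j) ^ \<eta>" for l j
  proof -
    have "real_of_int (p l $ j) = \<alpha> $ j * real (D * Suc l)"
      using D(2)[of j] by (simp add: p_def algebra_simps)
    moreover have "real (D * Suc l) ^ \<eta> \<noteq> 0" using D(1) by (simp del: of_nat_mult)
    moreover have "real (q l) = real (D * Suc l) ^ \<eta>" by (simp only: q_def of_nat_power)
    ultimately show ?thesis
      by (metis power_mult_distrib nonzero_mult_div_cancel_right)
  qed
  moreover have "filterlim q at_top sequentially"
    by (rule filterlim_at_top_mono[OF filterlim_ident]) (simp add: q)
  ultimately show ?thesis
    unfolding approximable_def using q by (intro exI[of _ 1] conjI exI[of _ p] exI[of _ q]) auto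
qed

lemma power_root_powr:
  fixes m \<rho> \<eta> :: nat
  assumes "m > 0" "\<eta> > 0"
  shows "(real m powr (real \<rho> / real \<eta>)) ^ \<eta> = real m ^ \<rho>"
  using assms by (simp add: powr_realpow[symmetric] powr_powr)

text \<open>Supplies distinct denominators. The condition \<open>l \<le> r l\<close> preserves the order of approximation and
\<open>1 \<le> r l\<close> avoids index zero, at which \<open>approximable\<close> asserts nothing.\<close>
lemma increasing_subsequence:
  fixes q :: "nat \<Rightarrow> nat"
  assumes "filterlim q at_top sequentially"
  obtains r :: "nat \<Rightarrow> nat" where "strict_mono (\<lambda>l. q (r l))" "\<And>l. l \<le> r l" "\<And>l. 1 \<le> r l"
proof -
  have "\<exists>r. \<forall>n. (n \<le> r n \<and> 1 \<le> r n) \<and> q (r n) < q (r (Suc n))"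
  proof (rule dependent_nat_choice)
    fix x n :: nat assume "n \<le> x \<and> 1 \<le> x"
    have "\<forall>\<^sub>F i in sequentially. Suc (q x) \<le> q i"
      using assms by (simp add: filterlim_at_top)
    then have "\<forall>\<^sub>F i in sequentially. Suc (q x) \<le> q i \<and> Suc n \<le> i"
      using eventually_ge_at_top eventually_conj by blast
    then obtain i where "Suc (q x) \<le> q i" "Suc n \<le> i"
      by (auto dest: eventually_happens)
    then show "\<exists>y. (Suc n \<le> y \<and> 1 \<le> y) \<and> q x < q y" by (intro exI[of _ i]) auto
  qed auto
  then show thesis using that by (metis strict_mono_Suc_iff)
qed

text \<open>Here \<open>R\<close> plays the role of \<open>\<xi>\<^sup>\<kappa>\<close> and \<open>k\<close> that of \<open>q\<^sup>a\<close>. An even \<open>\<eta>\<close> forgets the sign of \<open>b\<close>, so \<open>b\<close> is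
given the sign of \<open>a\<close>; for odd \<open>\<eta>\<close> this only improves the approximation. If \<open>a = 0\<close>, then
\<open>sgn a = 0\<close> replaces \<open>b\<close> by \<open>0\<close>.\<close>
lemma root_distance_le:
  fixes a b R C Q :: real
  assumes R: "R > 0" and \<eta>: "\<eta> > 0" and Rb: "R ^ \<eta> = Q * k ^ \<eta>" and Q: "Q > 0" and k: "k > 0"
    and ab: "\<bar>a ^ \<eta> - b ^ \<eta> / Q\<bar> \<le> e"
  shows "\<bar>R * a - sgn a * \<bar>b\<bar> * k\<bar> ^ \<eta> \<le> R ^ \<eta> * e"
proof (cases "a = 0")
  case True
  then have "0 \<le> e" using ab by linarith
  then show ?thesis using True R \<eta> by (simp add: zero_power)
next
  case False
  have "R * a - sgn a * \<bar>b\<bar> * k = sgn a * (R * \<bar>a\<bar> - \<bar>b\<bar> * k)"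
    by (simp add: algebra_simps abs_sgn[of a] sgn_mult_self_eq False)
  then have "\<bar>R * a - sgn a * \<bar>b\<bar> * k\<bar> = \<bar>R * \<bar>a\<bar> - \<bar>b\<bar> * k\<bar>"
    using False by (simp add: abs_mult abs_sgn_eq)
  then have "\<bar>R * a - sgn a * \<bar>b\<bar> * k\<bar> ^ \<eta> \<le> \<bar>(R * \<bar>a\<bar>) ^ \<eta> - (\<bar>b\<bar> * k) ^ \<eta>\<bar>"
    using abs_diff_power_le[of "R * \<bar>a\<bar>" "\<bar>b\<bar> * k" \<eta>] R k \<eta> by simp
  also have "(R * \<bar>a\<bar>) ^ \<eta> - (\<bar>b\<bar> * k) ^ \<eta> = R ^ \<eta> * (\<bar>a ^ \<eta>\<bar> - \<bar>b ^ \<eta> / Q\<bar>)"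
    using Q by (simp add: power_mult_distrib power_abs Rb right_diff_distrib)
  also have "\<bar>R ^ \<eta> * (\<bar>a ^ \<eta>\<bar> - \<bar>b ^ \<eta> / Q\<bar>)\<bar> \<le> R ^ \<eta> * \<bar>a ^ \<eta> - b ^ \<eta> / Q\<bar>"
    using R abs_triangle_ineq3[of "a ^ \<eta>" "b ^ \<eta> / Q"] by (simp add: abs_mult mult_left_mono)
  also have "\<dots> \<le> R ^ \<eta> * e" using ab R by (intro mult_left_mono) auto
  finally show ?thesis .
qed

text \<open>Coprimality yields \<open>\<rho> b = \<eta> a + 1\<close>. With \<open>m = Q\<^sup>b\<close> and \<open>\<tau>\<^sub>j = \<plusminus> p\<^sub>j Q\<^sup>a\<close> the quotient \<open>\<bar>\<tau>\<^sub>j\<bar>\<^sup>\<eta> / m\<^sup>\<rho>\<close> equals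
\<open>\<bar>p\<^sub>j\<bar>\<^sup>\<eta> / Q\<close>. All quantities other than the error grow at most polynomially in \<open>Q\<close>, while the error is of
size \<open>Q\<^sup>-\<^sup>l\<close>, so it beats every power of the weight.\<close>
lemma approximable_imp_small_symbol:
  fixes \<alpha> :: "real ^ 'n::finite"
  assumes appr: "approximable \<eta> \<alpha>" and \<rho>: "\<rho> > 0" and \<eta>: "\<eta> > 0" and cop: "coprime \<rho> \<eta>"
  obtains m :: "nat \<Rightarrow> nat" and \<tau> :: "nat \<Rightarrow> real ^ 'n"
  where "inj m" "\<And>l. m l > 0" "\<And>l j. \<tau> l $ j \<in> \<int>"
    "\<And>N. \<exists>B. \<forall>l j. \<bar>\<tau> l $ j + real (m l) powr (real \<rho> / real \<eta>) * \<alpha> $ j\<bar>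
        * weight (\<tau> l, real (m l)) ^ N \<le> B"
proof -
  obtain C p q where C: "C > 0" and qpos: "\<And>l. l \<ge> 1 \<Longrightarrow> q l > 0"
    and qlim: "filterlim q at_top sequentially"
    and close: "\<And>l j. l \<ge> 1 \<Longrightarrow>
      \<bar>(\<alpha> $ j) ^ \<eta> - real_of_int (p l $ j) ^ \<eta> / real (q l)\<bar> < C / real (q l) ^ l"
    using appr unfolding approximable_def by metis
  obtain r where r: "strict_mono (\<lambda>l. q (r l))" "\<And>l. l \<le> r l" "\<And>l. 1 \<le> r l"
    using increasing_subsequence[OF qlim] by blast
  define Q where "Q l = q (r l)" for l
  have Qmono: "strict_mono Q" using r(1) by (simp add: Q_def[abs_def])
  have Q1: "Q l \<ge> 1" for l using qpos[OF r(3)] by (simp add: Q_def Suc_le_eq)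
  have Qle: "Q l \<le> Q l'" if "l \<le> l'" for l l' using Qmono that by (simp add: strict_mono_less_eq)
  obtain b a where ba: "\<rho> * b = \<eta> * a + 1"
    using bezout_nat[of \<rho> \<eta>] \<rho> cop by auto
  have b: "b > 0" using ba by (cases b) auto
  define m where "m l = Q l ^ b" for l
  define \<tau> :: "nat \<Rightarrow> real ^ 'n"
    where "\<tau> l = (\<chi> j. - (sgn (\<alpha> $ j) * \<bar>real_of_int (p (r l) $ j)\<bar> * real (Q l) ^ a))" for l
  define R where "R l = real (m l) powr (real \<rho> / real \<eta>)" for l
  define E where "E l j = \<bar>\<tau> l $ j + R l * \<alpha> $ j\<bar>" for l j
  have mpos: "m l > 0" for l using Q1[of l] by (simp add: m_def)
  have R\<eta>: "R l ^ \<eta> = real (Q l) ^ (\<rho> * b)" for l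
    unfolding R_def power_root_powr[OF mpos \<eta>] by (simp add: m_def power_mult[symmetric] mult.commute)
  have close': "\<bar>(\<alpha> $ j) ^ \<eta> - real_of_int (p (r l) $ j) ^ \<eta> / real (Q l)\<bar> \<le> C / real (Q l) ^ l" for l j
  proof -
    have "real (Q l) ^ l \<le> real (Q l) ^ r l" using Q1[of l] r(2) by (intro power_increasing) auto
    then have "C / real (Q l) ^ r l \<le> C / real (Q l) ^ l"
      using Q1[of l] C by (intro divide_left_mono mult_pos_pos) auto
    then show ?thesis using close[OF r(3), of j l] by (simp add: Q_def)
  qed
  have E: "E l j ^ \<eta> \<le> real (Q l) ^ (\<rho> * b) * (C / real (Q l) ^ l)" for l j
  proof -
    have "E l j = \<bar>R l * \<alpha> $ j - sgn (\<alpha> $ j) * \<bar>real_of_int (p (r l) $ j)\<bar> * real (Q l) ^ a\<bar>"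
      by (simp add: E_def \<tau>_def)
    moreover have "R l ^ \<eta> = real (Q l) * (real (Q l) ^ a) ^ \<eta>"
      unfolding R\<eta> ba by (simp add: power_add power_mult[symmetric] mult.commute)
    moreover have "R l > 0" using mpos[of l] by (simp add: R_def)
    ultimately show ?thesis
      using root_distance_le[of "R l" \<eta> "real (Q l)" "real (Q l) ^ a" "\<alpha> $ j" "real_of_int (p (r l) $ j)"
          "C / real (Q l) ^ l"] \<eta> close' Q1[of l] R\<eta> by simp
  qed
  \<comment> \<open>The weight of \<open>(\<tau> l, m l)\<close> is at most \<open>K * Q l ^ A\<close>; the summand 2 absorbs 1 and \<open>m l\<close>.\<close>
  define K where "K = 2 + (\<Sum>j\<in>UNIV. \<bar>\<alpha> $ j\<bar> ^ \<eta> + C)"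
  define A where "A = b + a + 1"
  have \<tau>_le: "\<bar>\<tau> l $ j\<bar> \<le> (\<bar>\<alpha> $ j\<bar> ^ \<eta> + C) * real (Q l) ^ A" for l j
  proof -
    let ?p = "real_of_int (p (r l) $ j)" and ?Q = "real (Q l)"
    have Q1': "?Q \<ge> 1" using Q1[of l] by simp
    have "\<bar>?p ^ \<eta> / ?Q\<bar> \<le> \<bar>(\<alpha> $ j) ^ \<eta>\<bar> + C / ?Q ^ l"
      using close'[where l=l and j=j] by linarith
    also have "C / ?Q ^ l \<le> C" using C Q1' by (simp add: divide_le_eq)
    finally have "\<bar>?p\<bar> ^ \<eta> \<le> (\<bar>\<alpha> $ j\<bar> ^ \<eta> + C) * ?Q"
      using Q1' by (simp add: power_abs divide_le_eq)
    moreover have "\<bar>?p\<bar> \<le> \<bar>?p\<bar> ^ \<eta>"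
    proof (cases "p (r l) $ j = 0")
      case False
      then have "\<bar>p (r l) $ j\<bar> \<ge> 1" by linarith
      then have "\<bar>?p\<bar> \<ge> 1" by linarith
      then show ?thesis using \<eta> by (intro self_le_power) auto
    qed (use \<eta> in auto)
    ultimately have p: "\<bar>?p\<bar> \<le> (\<bar>\<alpha> $ j\<bar> ^ \<eta> + C) * ?Q" by linarith
    have "\<bar>\<tau> l $ j\<bar> \<le> \<bar>?p\<bar> * ?Q ^ a"
      by (auto simp: \<tau>_def abs_mult abs_sgn_eq)
    also have "\<dots> \<le> ((\<bar>\<alpha> $ j\<bar> ^ \<eta> + C) * ?Q) * ?Q ^ a"
      using p by (intro mult_right_mono) auto
    also have "\<dots> = (\<bar>\<alpha> $ j\<bar> ^ \<eta> + C) * ?Q ^ (a + 1)" by simp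
    also have "\<dots> \<le> (\<bar>\<alpha> $ j\<bar> ^ \<eta> + C) * ?Q ^ A"
      using Q1' C by (intro mult_left_mono power_increasing) (auto simp: A_def)
    finally show ?thesis .
  qed
  have w: "weight (\<tau> l, real (m l)) \<le> K * real (Q l) ^ A" for l
  proof -
    have "norm (\<tau> l, real (m l)) \<le> norm (\<tau> l) + real (m l)"
      using norm_Pair_le[of "\<tau> l" "real (m l)"] by simp
    also have "norm (\<tau> l) \<le> (\<Sum>j\<in>UNIV. \<bar>\<tau> l $ j\<bar>)" by (rule norm_le_l1_cart)
    also have "\<dots> \<le> (\<Sum>j\<in>UNIV. (\<bar>\<alpha> $ j\<bar> ^ \<eta> + C) * real (Q l) ^ A)"
      by (intro sum_mono \<tau>_le)
    also have "\<dots> = (\<Sum>j\<in>UNIV. \<bar>\<alpha> $ j\<bar> ^ \<eta> + C) * real (Q l) ^ A"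
      by (rule sum_distrib_right[symmetric])
    also have "real (m l) \<le> real (Q l) ^ A"
      using Q1[of l] unfolding m_def of_nat_power by (intro power_increasing) (auto simp: A_def)
    moreover have "1 \<le> real (Q l) ^ A" using Q1[of l] by (intro one_le_power) auto
    ultimately show ?thesis unfolding weight_def K_def distrib_right by linarith
  qed
  have K0: "K \<ge> 0" unfolding K_def using C by (intro add_nonneg_nonneg sum_nonneg) auto
  show thesis
  proof (rule that)
    show "inj m"
    proof (rule strict_mono_imp_inj_on, rule strict_monoI)
      show "m x < m y" if "x < y" for x y
        unfolding m_def using strict_monoD[OF Qmono that] b by (intro power_strict_mono) auto
    qed
    show "m l > 0" for l by (rule mpos)
    have "sgn (x::real) \<in> \<int>" for x by (simp add: sgn_if)
    then show "\<tau> l $ j \<in> \<int>" for l j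
      by (auto simp: \<tau>_def intro!: Ints_mult Ints_power)
    fix N
    \<comment> \<open>The total power of \<open>Q l\<close> to be compensated: for \<open>l > T\<close> the error wins, and the remaining indices are bounded by monotonicity of \<open>Q\<close>.\<close>
    define T where "T = \<rho> * b + A * (N * \<eta>)"
    define B where "B = C * K ^ (N * \<eta>) * real (Q T) ^ T"
    have B0: "B \<ge> 0" unfolding B_def using C K0 by simp
    have "E l j * weight (\<tau> l, real (m l)) ^ N \<le> 1 + B" for l j
    proof -
      let ?x = "E l j * weight (\<tau> l, real (m l)) ^ N" and ?Q = "real (Q l)"
      have Q1': "?Q \<ge> 1" using Q1[of l] by simp
      have "?x ^ \<eta> = E l j ^ \<eta> * weight (\<tau> l, real (m l)) ^ (N * \<eta>)"
        by (simp add: power_mult_distrib power_mult)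
      also have "\<dots> \<le> (?Q ^ (\<rho> * b) * (C / ?Q ^ l)) * (K * ?Q ^ A) ^ (N * \<eta>)"
        using C by (intro mult_mono E power_mono w) auto
      also have "\<dots> = C * K ^ (N * \<eta>) * (?Q ^ T / ?Q ^ l)"
        by (simp add: T_def power_mult_distrib power_add power_mult)
      also have "\<dots> \<le> C * K ^ (N * \<eta>) * real (Q T) ^ T"
      proof (rule mult_left_mono)
        show "?Q ^ T / ?Q ^ l \<le> real (Q T) ^ T"
        proof (cases "l \<le> T")
          case True
          have "?Q ^ T / ?Q ^ l \<le> ?Q ^ T" using Q1' by (simp add: divide_le_eq mult_le_cancel_left1)
          also have "\<dots> \<le> real (Q T) ^ T" using Qle[OF True] by (intro power_mono) auto
          finally show ?thesis .
        next
          case False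
          then have "?Q ^ T \<le> ?Q ^ l" using Q1' by (intro power_increasing) auto
          then have "?Q ^ T / ?Q ^ l \<le> 1" using Q1' by (simp add: divide_le_eq)
          also have "1 \<le> real (Q T) ^ T" using Q1[of T] by (intro one_le_power) auto
          finally show ?thesis .
        qed
      qed (use C K0 in simp)
      finally have xB: "?x ^ \<eta> \<le> B" by (simp only: B_def)
      show ?thesis
      proof (cases "?x \<le> 1")
        case True
        then show ?thesis using B0 by linarith
      next
        case False
        then have "?x \<le> ?x ^ \<eta>" using \<eta> by (intro self_le_power) auto
        then show ?thesis using xB by linarith
      qed
    qed
    then show "\<exists>B. \<forall>l j. \<bar>\<tau> l $ j + real (m l) powr (real \<rho> / real \<eta>) * \<alpha> $ j\<bar>
        * weight (\<tau> l, real (m l)) ^ N \<le> B"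
      unfolding E_def R_def by blast
  qed
qed

text \<open>If the bound with \<open>M = \<rho> l\<close> failed for every \<open>l\<close>, then the counterexamples \<open>(m, \<tau>)\<close> would approximate
\<open>\<alpha>\<^sub>j\<close> by \<open>- \<tau>\<^sub>j / m\<^sup>\<kappa>\<close>, and \<open>\<eta>\<close>-th powers would give approximations with denominators \<open>m\<^sup>\<rho>\<close>.\<close>
lemma not_approximable_imp_symbol_lower_bound:
  fixes \<alpha> :: "real ^ 'n::finite"
  assumes appr: "\<not> approximable \<eta> \<alpha>" and \<rho>: "\<rho> > 0" and \<eta>: "\<eta> > 0"
  obtains L M :: nat where
    "\<And>m (\<tau> :: real ^ 'n). m \<ge> L \<Longrightarrow> (\<And>j. \<tau> $ j \<in> \<int>) \<Longrightarrow>
      \<exists>j. 1 \<le> \<bar>\<tau> $ j + real m powr (real \<rho> / real \<eta>) * \<alpha> $ j\<bar> * real m ^ M"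
proof (rule ccontr)
  assume "\<not> thesis"
  then have "\<exists>m (\<tau> :: real ^ 'n). m \<ge> Suc l \<and> (\<forall>j. \<tau> $ j \<in> \<int>) \<and>
      (\<forall>j. \<bar>\<tau> $ j + real m powr (real \<rho> / real \<eta>) * \<alpha> $ j\<bar> * real m ^ (\<rho> * l) < 1)" for l
    using that[of "Suc l" "\<rho> * l"] by (meson not_less)
  then obtain m and \<tau> :: "nat \<Rightarrow> real ^ 'n" where m: "\<And>l. m l \<ge> Suc l" and \<tau>: "\<And>l j. \<tau> l $ j \<in> \<int>"
    and small: "\<And>l j. \<bar>\<tau> l $ j + real (m l) powr (real \<rho> / real \<eta>) * \<alpha> $ j\<bar> * real (m l) ^ (\<rho> * l) < 1"
    by metis
  define q where "q l = m l ^ \<rho>" for l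
  define p :: "nat \<Rightarrow> int ^ 'n" where "p l = (\<chi> j. \<lfloor>- \<tau> l $ j\<rfloor>)" for l
  have p: "real_of_int (p l $ j) = - \<tau> l $ j" for l j
    using \<tau>[of l j] by (simp add: p_def)
  define C where "C = 1 + (\<Sum>j\<in>UNIV. real \<eta> * (\<bar>\<alpha> $ j\<bar> + 1) ^ \<eta>)"
  have C: "C > 0" unfolding C_def by (intro add_pos_nonneg sum_nonneg) auto
  have Cj: "real \<eta> * (\<bar>\<alpha> $ j\<bar> + 1) ^ \<eta> \<le> C" for j
  proof -
    have "real \<eta> * (\<bar>\<alpha> $ j\<bar> + 1) ^ \<eta> \<le> (\<Sum>j\<in>UNIV. real \<eta> * (\<bar>\<alpha> $ j\<bar> + 1) ^ \<eta>)"
      by (rule member_le_sum[of j UNIV "\<lambda>j. real \<eta> * (\<bar>\<alpha> $ j\<bar> + 1) ^ \<eta>"]) auto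
    then show ?thesis by (simp add: C_def)
  qed
  have "\<bar>(\<alpha> $ j) ^ \<eta> - real_of_int (p l $ j) ^ \<eta> / real (q l)\<bar> < C / real (q l) ^ l" for l j
  proof -
    define R where "R = real (m l) powr (real \<rho> / real \<eta>)"
    define y where "y = - \<tau> l $ j / R"
    have m1: "real (m l) \<ge> 1" using m[of l] by simp
    have R1: "R \<ge> 1" unfolding R_def using m1 by (intro ge_one_powr_ge_zero) auto
    have "R ^ \<eta> = real (q l)"
      unfolding R_def q_def using power_root_powr[of "m l" \<eta> \<rho>] m[of l] \<eta> by simp
    then have y: "y ^ \<eta> = real_of_int (p l $ j) ^ \<eta> / real (q l)"
      by (simp only: y_def p power_divide)
    have q1: "real (q l) ^ l \<ge> 1" "real (q l) ^ l = real (m l) ^ (\<rho> * l)"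
      using m1 by (auto simp: q_def power_mult one_le_power)
    have "\<alpha> $ j - y = (\<tau> l $ j + R * \<alpha> $ j) / R"
      using R1 by (simp add: y_def add_divide_distrib)
    then have "\<bar>\<alpha> $ j - y\<bar> = \<bar>\<tau> l $ j + R * \<alpha> $ j\<bar> / R"
      using R1 by (simp add: abs_divide)
    also have "\<dots> \<le> \<bar>\<tau> l $ j + R * \<alpha> $ j\<bar>" using R1 by (simp add: divide_le_eq mult_le_cancel_left1)
    also have "\<dots> < 1 / real (q l) ^ l"
    proof -
      have "0 < real (m l) ^ (\<rho> * l)" using m1 by simp
      then show ?thesis using small[of l j] q1(2) by (simp add: R_def[symmetric] pos_less_divide_eq)
    qed
    finally have d: "\<bar>\<alpha> $ j - y\<bar> < 1 / real (q l) ^ l" .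
    also have "\<dots> \<le> 1" using q1(1) by (intro divide_le_eq_1[THEN iffD2] disjI1 conjI) linarith+
    finally have "\<bar>y\<bar> \<le> \<bar>\<alpha> $ j\<bar> + 1" by linarith
    then have "\<bar>(\<alpha> $ j) ^ \<eta> - y ^ \<eta>\<bar> \<le> real \<eta> * (\<bar>\<alpha> $ j\<bar> + 1) ^ \<eta> * \<bar>\<alpha> $ j - y\<bar>"
      by (intro power_diff_le) auto
    also have "\<dots> \<le> C * \<bar>\<alpha> $ j - y\<bar>" by (intro mult_right_mono Cj) auto
    also have "\<dots> < C * (1 / real (q l) ^ l)" using d C by (rule mult_strict_left_mono)
    finally show ?thesis by (simp add: y)
  qed
  moreover have "l \<le> q l" "q l > 0" for l
  proof -
    have "l \<le> m l" using m[of l] by simp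
    also have "\<dots> \<le> q l" unfolding q_def using m[of l] \<rho> by (intro self_le_power) auto
    finally show "l \<le> q l" .
    show "q l > 0" using m[of l] by (simp add: q_def)
  qed
  moreover from this have "filterlim q at_top sequentially"
    by (intro filterlim_at_top_mono[OF filterlim_ident]) simp
  ultimately have "approximable \<eta> \<alpha>"
    unfolding approximable_def using C by (intro exI[of _ C] conjI exI[of _ p] exI[of _ q]) auto
  then show False using appr by blast
qed

text \<open>If \<open>\<beta> \<noteq> 0\<close>, the imaginary part of one of the symbols is already bounded below, since the frequencies
\<open>\<tau>\<close> are real.\<close>
lemma homogeneous_symbol_lower_bound:
  fixes \<alpha> \<beta> :: "real ^ 'n::finite"
  assumes appr: "\<beta> = 0 \<Longrightarrow> \<not> approximable \<eta> \<alpha>" and \<rho>: "\<rho> > 0" and \<eta>: "\<eta> > 0"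
  obtains L M :: nat and c :: real where "c > 0"
    "\<And>m (\<tau> :: real ^ 'n). m \<ge> L \<Longrightarrow> (\<And>j. \<tau> $ j \<in> \<int>) \<Longrightarrow>
      \<exists>j. c \<le> norm (of_real (\<tau> $ j) + of_real (real m powr (real \<rho> / real \<eta>)) *
        (of_real (\<alpha> $ j) + \<i> * of_real (\<beta> $ j))) * real m ^ M"
proof (cases "\<beta> = 0")
  case True
  obtain L M :: nat where LM: "\<And>m (\<tau> :: real ^ 'n). m \<ge> L \<Longrightarrow> (\<And>j. \<tau> $ j \<in> \<int>) \<Longrightarrow>
      \<exists>j. 1 \<le> \<bar>\<tau> $ j + real m powr (real \<rho> / real \<eta>) * \<alpha> $ j\<bar> * real m ^ M"
    using not_approximable_imp_symbol_lower_bound[OF appr[OF True] \<rho> \<eta>] by metis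
  have "norm (of_real (\<tau> $ j) + of_real R * (of_real (\<alpha> $ j) + \<i> * of_real (\<beta> $ j))) = \<bar>\<tau> $ j + R * \<alpha> $ j\<bar>"
    for \<tau> :: "real ^ 'n" and R j
    using True by (simp flip: of_real_mult of_real_add)
  then show thesis using that[of 1 L M] LM by simp
next
  case False
  then obtain i where i: "\<beta> $ i \<noteq> 0" by (auto simp: vec_eq_iff)
  show thesis
  proof (rule that[of "\<bar>\<beta> $ i\<bar>" 1 0])
    fix m :: nat and \<tau> :: "real ^ 'n" assume m: "m \<ge> 1"
    define R where "R = real m powr (real \<rho> / real \<eta>)"
    have R: "R \<ge> 1" unfolding R_def using m by (intro ge_one_powr_ge_zero) auto
    let ?z = "of_real (\<tau> $ i) + of_real R * (of_real (\<alpha> $ i) + \<i> * of_real (\<beta> $ i))"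
    have "\<bar>\<beta> $ i\<bar> \<le> \<bar>R * \<beta> $ i\<bar>" using R by (simp add: abs_mult mult_le_cancel_right1)
    also have "\<dots> = \<bar>Im ?z\<bar>" by simp
    also have "\<dots> \<le> norm ?z" by (rule abs_Im_le_cmod)
    finally show "\<exists>j. \<bar>\<beta> $ i\<bar> \<le> norm (of_real (\<tau> $ j) + of_real (real m powr (real \<rho> / real \<eta>)) *
        (of_real (\<alpha> $ j) + \<i> * of_real (\<beta> $ j))) * real m ^ 0"
      unfolding R_def by auto
  qed (use i in auto)
qed

section \<open>The characterisation\<close>

theorem theorem2p10:
  fixes \<rho> \<eta> :: nat and \<kappa> :: real
    and p :: "'n::finite \<Rightarrow> int \<Rightarrow> complex"
    and \<alpha> \<beta> \<alpha>' \<beta>' :: "real ^ 'n"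
  assumes "\<rho> > 0" and "\<eta> > 0" and "coprime \<rho> \<eta>"
    and "\<kappa> = real \<rho> / real \<eta>"
    and "\<And>j \<xi>. \<xi> > 0 \<Longrightarrow> p j \<xi> = complex_of_real (\<bar>real_of_int \<xi>\<bar> powr \<kappa>) * p j 1"
    and "\<And>j \<xi>. \<xi> < 0 \<Longrightarrow> p j \<xi> = complex_of_real (\<bar>real_of_int \<xi>\<bar> powr \<kappa>) * p j (- 1)"
    and "\<And>j. p j 1 = complex_of_real (\<alpha> $ j) + \<i> * complex_of_real (\<beta> $ j)"
    and "\<And>j. p j (- 1) = complex_of_real (\<alpha>' $ j) + \<i> * complex_of_real (\<beta>' $ j)"
  shows "globally_hypoelliptic (system_op p) \<longleftrightarrow>
    (\<beta> = 0 \<longrightarrow> \<not> rational_vec \<alpha> \<and> \<not> SDA \<eta> \<alpha>) \<and>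
    (\<beta>' = 0 \<longrightarrow> \<not> rational_vec \<alpha>' \<and> \<not> SDA \<eta> \<alpha>')"
proof -
  have cond: "\<not> rational_vec v \<and> \<not> SDA \<eta> v \<longleftrightarrow> \<not> approximable \<eta> v" for v :: "real ^ 'n"
    using rational_imp_approximable[OF _ \<open>\<eta> > 0\<close>] by (auto simp: SDA_iff)
  have pos: "p j (int m) = of_real (real m powr (real \<rho> / real \<eta>)) * (of_real (\<alpha> $ j) + \<i> * of_real (\<beta> $ j))"
    if "m > 0" for j m
    using assms(5)[of "int m" j] that by (simp add: assms(4,7))
  have neg: "p j (- int m) = of_real (real m powr (real \<rho> / real \<eta>)) * (of_real (\<alpha>' $ j) + \<i> * of_real (\<beta>' $ j))"
    if "m > 0" for j m
    using assms(6)[of "- int m" j] that by (simp add: assms(4,8))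
  have not_gh: "\<not> globally_hypoelliptic (system_op p)"
    if appr: "approximable \<eta> v" and s: "s = 1 \<or> s = - 1"
      and psym: "\<And>j m. m > 0 \<Longrightarrow> p j (s * int m) = of_real (real m powr (real \<rho> / real \<eta>)) * of_real (v $ j)"
    for v :: "real ^ 'n" and s :: int
  proof -
    obtain m and \<tau> :: "nat \<Rightarrow> real ^ 'n" where m: "inj m" "\<And>l. m l > 0" and \<tau>: "\<And>l j. \<tau> l $ j \<in> \<int>"
      and small: "\<And>N. \<exists>B. \<forall>l j. \<bar>\<tau> l $ j + real (m l) powr (real \<rho> / real \<eta>) * v $ j\<bar>
        * weight (\<tau> l, real (m l)) ^ N \<le> B"
      using approximable_imp_small_symbol[OF appr assms(1-3)] by metis
    show ?thesis
    proof (rule not_globally_hypoelliptic_if_symbol_decays[where \<tau> = \<tau> and \<xi> = "\<lambda>l. s * int (m l)"])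
      show "inj (\<lambda>l. s * int (m l))" using m(1) s by (auto simp: inj_on_def)
      show "\<tau> l $ j \<in> \<int>" for l j by (rule \<tau>)
      fix j
      have "weight (\<tau> l, real_of_int (s * int (m l))) = weight (\<tau> l, real (m l))" for l
        using s by (auto simp: weight_def norm_prod_def)
      moreover have "norm (of_real (\<tau> l $ j) + p j (s * int (m l))) =
          \<bar>\<tau> l $ j + real (m l) powr (real \<rho> / real \<eta>) * v $ j\<bar>" for l
        unfolding psym[OF m(2)] by (metis norm_of_real of_real_add of_real_mult)
      ultimately show "rapidly_decaying (\<lambda>l. (\<tau> l, real_of_int (s * int (m l))))
          (\<lambda>l. of_real (\<tau> l $ j) + p j (s * int (m l)))"
        unfolding rapidly_decaying_def using small by metis
    qed
  qed
  have gh: "globally_hypoelliptic (system_op p)"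
    if \<alpha>: "\<beta> = 0 \<Longrightarrow> \<not> approximable \<eta> \<alpha>" and \<alpha>': "\<beta>' = 0 \<Longrightarrow> \<not> approximable \<eta> \<alpha>'"
  proof -
    obtain L M c where c: "c > 0" and lower: "\<And>m (\<tau> :: real ^ 'n). m \<ge> L \<Longrightarrow> (\<And>j. \<tau> $ j \<in> \<int>) \<Longrightarrow>
      \<exists>j. c \<le> norm (of_real (\<tau> $ j) + of_real (real m powr (real \<rho> / real \<eta>)) *
        (of_real (\<alpha> $ j) + \<i> * of_real (\<beta> $ j))) * real m ^ M"
      using homogeneous_symbol_lower_bound[OF \<alpha> assms(1,2)] by metis
    obtain L' M' c' where c': "c' > 0" and lower': "\<And>m (\<tau> :: real ^ 'n). m \<ge> L' \<Longrightarrow> (\<And>j. \<tau> $ j \<in> \<int>) \<Longrightarrow>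
      \<exists>j. c' \<le> norm (of_real (\<tau> $ j) + of_real (real m powr (real \<rho> / real \<eta>)) *
        (of_real (\<alpha>' $ j) + \<i> * of_real (\<beta>' $ j))) * real m ^ M'"
      using homogeneous_symbol_lower_bound[OF \<alpha>' assms(1,2)] by metis
    \<comment> \<open>Outside \<open>- K<..<K\<close> the two one-sided bounds apply. Inside, where also the arbitrary value \<open>p j 0\<close> occurs, finitely many symbol values are bounded by \<open>S\<close>, so a frequency of weight above \<open>R\<close> has a coordinate of \<open>\<tau>\<close> that dominates them.\<close>
    define K where "K = int (max 1 (max L L'))"
    define S where "S = 1 + (\<Sum>\<xi>\<in>{- K..K}. \<Sum>j\<in>UNIV. norm (p j \<xi>))"
    define R where "R = 1 + real CARD('n) * S + of_int K"
    show ?thesis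
    proof (rule globally_hypoelliptic_if_symbol_bounded_below
        [where c = "min 1 (min c c')" and M = "M + M'" and R = R])
      show "min 1 (min c c') > 0" using c c' by simp
      fix \<tau> :: "real ^ 'n" and \<xi> :: int
      assume \<tau>: "\<forall>j. \<tau> $ j \<in> \<int>" and big: "weight (\<tau>, real_of_int \<xi>) > R"
      let ?w = "weight (\<tau>, real_of_int \<xi>)" and ?m = "nat \<bar>\<xi>\<bar>"
      have mw: "real ?m \<le> ?w"
        using norm_snd_le[of "real_of_int \<xi>" \<tau>] by (simp add: weight_def)
      have up: "\<exists>j. min 1 (min c c') \<le> norm (of_real (\<tau> $ j) + p j \<xi>) * ?w ^ (M + M')"
        if "e \<le> norm (of_real (\<tau> $ j) + p j \<xi>) * real ?m ^ k" "min 1 (min c c') \<le> e" "k \<le> M + M'"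
        for e j k
      proof (rule exI)
        have "real ?m ^ k \<le> ?w ^ k" using mw by (intro power_mono) auto
        also have "\<dots> \<le> ?w ^ (M + M')" using that(3) by (intro power_increasing) auto
        finally have "norm (of_real (\<tau> $ j) + p j \<xi>) * real ?m ^ k \<le>
            norm (of_real (\<tau> $ j) + p j \<xi>) * ?w ^ (M + M')"
          by (intro mult_left_mono) auto
        then show "min 1 (min c c') \<le> norm (of_real (\<tau> $ j) + p j \<xi>) * ?w ^ (M + M')"
          using that by linarith
      qed
      consider "\<xi> \<ge> K" | "\<xi> \<le> - K" | "\<xi> \<in> {- K..K}" by fastforce
      then show "\<exists>j. min 1 (min c c') \<le> norm (of_real (\<tau> $ j) + p j \<xi>) * ?w ^ (M + M')"
      proof cases
        case 1
        then have m: "?m \<ge> L" "?m > 0" "\<xi> = int ?m" by (auto simp: K_def)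
        obtain j where "c \<le> norm (of_real (\<tau> $ j) + p j (int ?m)) * real ?m ^ M"
          using lower[OF m(1), of \<tau>] \<tau> unfolding pos[OF m(2)] by blast
        then show ?thesis using up[of c j M] m(3) by auto
      next
        case 2
        then have m: "?m \<ge> L'" "?m > 0" "\<xi> = - int ?m" by (auto simp: K_def)
        obtain j where "c' \<le> norm (of_real (\<tau> $ j) + p j (- int ?m)) * real ?m ^ M'"
          using lower'[OF m(1), of \<tau>] \<tau> unfolding neg[OF m(2)] by blast
        then show ?thesis using up[of c' j M'] m(3) by auto
      next
        case 3
        have "\<exists>j. 1 \<le> norm (of_real (\<tau> $ j) + p j \<xi>)"
        proof (rule ccontr)
          assume "\<not> ?thesis"
          then have less: "norm (of_real (\<tau> $ j) + p j \<xi>) < 1" for j by (simp add: not_le)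
          have "\<bar>\<tau> $ j\<bar> \<le> S" for j
          proof -
            have "\<bar>\<tau> $ j\<bar> \<le> norm (of_real (\<tau> $ j) + p j \<xi>) + norm (p j \<xi>)"
              using norm_triangle_ineq4[of "of_real (\<tau> $ j) + p j \<xi>" "p j \<xi>"] by simp
            moreover have "norm (p j \<xi>) \<le> (\<Sum>j\<in>UNIV. norm (p j \<xi>))"
              by (rule member_le_sum[of j UNIV "\<lambda>j. norm (p j \<xi>)"]) auto
            moreover have "\<dots> \<le> (\<Sum>\<xi>\<in>{- K..K}. \<Sum>j\<in>UNIV. norm (p j \<xi>))"
              using 3 by (intro member_le_sum[of \<xi> _ "\<lambda>\<xi>. \<Sum>j\<in>UNIV. norm (p j \<xi>)"] sum_nonneg) auto
            ultimately show ?thesis using less[of j] by (simp add: S_def)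
          qed
          then have "(\<Sum>j\<in>UNIV. \<bar>\<tau> $ j\<bar>) \<le> real CARD('n) * S"
            using sum_bounded_above[of UNIV "\<lambda>j. \<bar>\<tau> $ j\<bar>" S] by simp
          then have "norm \<tau> \<le> real CARD('n) * S" using norm_le_l1_cart[of \<tau>] by linarith
          moreover have "norm (real_of_int \<xi>) \<le> of_int K" using 3 by auto
          ultimately have "?w \<le> R"
            using norm_Pair_le[of \<tau> "real_of_int \<xi>"] by (simp add: weight_def R_def)
          then show False using big by linarith
        qed
        then show ?thesis using up[of 1 _ 0] by auto
      qed
    qed
  qed
  have "\<not> approximable \<eta> \<alpha>" if "globally_hypoelliptic (system_op p)" "\<beta> = 0"
    using not_gh[of \<alpha> 1] that pos by auto
  moreover have "\<not> approximable \<eta> \<alpha>'" if "globally_hypoelliptic (system_op p)" "\<beta>' = 0"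
    using not_gh[of \<alpha>' "- 1"] that neg by auto
  ultimately show ?thesis unfolding cond using gh by blast
qed

end
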